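(* Let $n\ge 2$, let $P_n$ be the path graph on $n$ vertices, let $r\geq 0$ be an integer, and set $k=\lfloor n/2\rfloor$ and $q=\min(k,r+1)$. For every integer $l\ge -1$ the graded Betti numbers of the ideal $NI(P_n)$ are given as follows. If $d=r+2l+3$, then $$\begin{aligned}\beta_{r,d}(NI(P_n))={}&\binom{|k-r-1|}{k-r-1}\,\delta_{d,2r+2}+\binom{n-2l-r-4}{2l-r+1}\Bigg[\binom{n-3l-3}{r-l}-\binom{n-3l-4-\lfloor q/2\rfloor}{r-l-1-\lfloor q/2\rfloor}\\&+\binom{n-3l-4}{r-l-1}-\binom{n-3l-3-\lceil q/2\rceil}{r-l-\lceil q/2\rceil}\Bigg]+\left(\frac{1+(-1)^{n-1}}{2}\right)\delta_{r,k}\,\delta_{d,2r+1}.\end{aligned}$$ If $d=r+2l+4$, then $$\begin{aligned}\beta_{r,d}(NI(P_n))={}&\binom{|k-r-1|}{k-r-1}\,\delta_{d,2r+2}+\binom{n-2l-r-5}{2l-r+2}\Bigg[2\binom{n-3l-5}{r-l-1}-\binom{n-3l-5-\lfloor q/2\rfloor}{r-l-1-\lfloor q/2\rfloor}\\&-\binom{n-3l-5-\lceil q/2\rceil}{r-l-1-\lceil q/2\rceil}\Bigg]+\left(\frac{1+(-1)^{n-1}}{2}\right)\delta_{r,k}\,\delta_{d,2r+1}.\end{aligned}$$ Here $\delta_{i,j}$ is the Kronecker delta.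
   Context: $P_n$ is the graph on $\{x_1,\dots,x_n\}$ with edges $\{x_i,x_{i+1}\}$, $1\le i\le n-1$. For a graph $G$ on $\{x_1,\dots,x_n\}$, the closed neighborhood ideal is $NI(G)=\langle \prod_{y\in N_G[v]}y : v\in V(G)\rangle\subseteq R=\mathbb{K}[x_1,\dots,x_n]$ ($\mathbb{K}$ a field), where $N_G[v]$ is $v$ together with its neighbors. For an ideal $I$, $\beta_{r,d}(I)$ is the rank of the degree-$d$ part $R(-d)^{\beta_{r,d}(I)}$ of the $r$-th module in the minimal graded free resolution of $I$ as an $R$-module, so $\beta_{r,d}(I)=\beta_{r+1,d}(R/I)$ for $r\ge0$. Binomial coefficient convention: $\binom{a}{b}$ is the usual binomial coefficient for $0\le b\le a$ (in particular $\binom00=1$), and $\binom{a}{b}=0$ for all other integers $a,b$ (in particular whenever $a<0$ or $b<0$). *)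

theory Defs
  imports
    "HOL-Library.Poly_Mapping"
    "HOL-Algebra.Ideal"
    "Jordan_Normal_Form.Matrix"
begin

text \<open>
  A polynomial maps exponent vectors (finitely supported functions from variable indices to
  exponents) to coefficients. The type has the variables \<open>x\<^sub>i\<close> for all naturals \<open>i\<close>; the ring
  \<open>K[x\<^sub>1, \<dots>, x\<^sub>n]\<close> is carved out by its carrier.
\<close>

type_synonym 'k mpoly = "(nat \<Rightarrow>\<^sub>0 nat) \<Rightarrow>\<^sub>0 'k"

definition var :: "nat \<Rightarrow> 'k::field mpoly" where
  "var i = Poly_Mapping.single (Poly_Mapping.single i 1) 1"

definition poly_ring :: "nat \<Rightarrow> 'k::field mpoly ring" where
  "poly_ring n =
     \<lparr>carrier = {p. \<forall>m\<in>Poly_Mapping.keys p. Poly_Mapping.keys m \<subseteq> {1..n}},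
      monoid.mult = (*), one = 1, zero = 0, add = (+)\<rparr>"

lemma cring_poly_ring: "cring (poly_ring n :: 'k::field mpoly ring)"
proof -
  have add: "p + q \<in> carrier (poly_ring n)"
    if "p \<in> carrier (poly_ring n)" "q \<in> carrier (poly_ring n)" for p q :: "'k mpoly"
    using that Poly_Mapping.keys_add[of p q] by (auto simp: poly_ring_def)
  have mult: "p * q \<in> carrier (poly_ring n)"
    if "p \<in> carrier (poly_ring n)" "q \<in> carrier (poly_ring n)" for p q :: "'k mpoly"
    unfolding poly_ring_def partial_object.simps mem_Collect_eq
  proof
    fix m assume "m \<in> Poly_Mapping.keys (p * q)"
    then obtain a b where "m = a + b" "a \<in> Poly_Mapping.keys p" "b \<in> Poly_Mapping.keys q"
      using keys_mult[of p q] by auto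
    thus "Poly_Mapping.keys m \<subseteq> {1..n}"
      using that Poly_Mapping.keys_add[of a b] unfolding poly_ring_def by fastforce
  qed
  have uminus: "- p \<in> carrier (poly_ring n)" if "p \<in> carrier (poly_ring n)" for p :: "'k mpoly"
    using that by (simp add: poly_ring_def)
  have zero_one: "0 \<in> carrier (poly_ring n :: 'k mpoly ring)"
      "1 \<in> carrier (poly_ring n :: 'k mpoly ring)"
    by (auto simp: poly_ring_def)
  have ops: "x \<oplus>\<^bsub>poly_ring n\<^esub> y = x + y" "x \<otimes>\<^bsub>poly_ring n\<^esub> y = x * y"
      "\<zero>\<^bsub>poly_ring n\<^esub> = (0 :: 'k mpoly)" "\<one>\<^bsub>poly_ring n\<^esub> = (1 :: 'k mpoly)" for x y :: "'k mpoly"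
    by (simp_all add: poly_ring_def)
  show ?thesis
  proof (rule cringI)
    show "abelian_group (poly_ring n :: 'k mpoly ring)"
    proof (rule abelian_groupI)
      fix p :: "'k mpoly" assume p: "p \<in> carrier (poly_ring n)"
      show "\<exists>q\<in>carrier (poly_ring n). q \<oplus>\<^bsub>poly_ring n\<^esub> p = \<zero>\<^bsub>poly_ring n\<^esub>"
        by (rule bexI[OF _ uminus[OF p]]) (simp add: ops)
    qed (simp_all add: ops add zero_one ac_simps)
    show "comm_monoid (poly_ring n :: 'k mpoly ring)"
      by (rule comm_monoidI) (simp_all add: ops mult zero_one ac_simps)
  qed (simp add: ops distrib_right)
qed

text \<open>Degrees are integers because twists of graded modules are; \<open>0\<close> is homogeneous of every degree.\<close>

definition homogeneous :: "int \<Rightarrow> 'k::field mpoly \<Rightarrow> bool" where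
  "homogeneous e p \<longleftrightarrow>
     (\<forall>m\<in>Poly_Mapping.keys p. int (\<Sum>i\<in>Poly_Mapping.keys m. Poly_Mapping.lookup m i) = e)"


text \<open>A graph is given by its vertex set and its set of two-element edges.\<close>

definition path_edges :: "nat \<Rightarrow> nat set set" where
  "path_edges n = {{i, i + 1} | i. 1 \<le> i \<and> i + 1 \<le> n}"

definition closed_neighborhood :: "nat set \<Rightarrow> nat set set \<Rightarrow> nat \<Rightarrow> nat set" where
  "closed_neighborhood V E v = {u \<in> V. u = v \<or> {u, v} \<in> E}"

definition neighborhood_ideal :: "nat \<Rightarrow> nat set set \<Rightarrow> 'k::field mpoly set" where
  "neighborhood_ideal n E =
     Idl\<^bsub>poly_ring n\<^esub> ((\<lambda>v. \<Prod>y\<in>closed_neighborhood {1..n} E v. var y) ` {1..n})"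


definition free_module :: "nat \<Rightarrow> nat \<Rightarrow> 'k::field mpoly vec set" where
  "free_module n s = {v \<in> carrier_vec s. \<forall>j<s. v $ j \<in> carrier (poly_ring n)}"

text \<open>
  Data of a complex \<open>\<cdots> \<rightarrow> F\<^sub>2 \<rightarrow> F\<^sub>1 \<rightarrow> F\<^sub>0 \<rightarrow> I\<close> of finitely generated graded free modules:
  \<open>F\<^sub>i\<close> is the direct sum of the \<open>R(-d)\<close> for \<open>d\<close> in the list \<open>shifts F i\<close>, the map
  \<open>F\<^sub>i\<^sub>+\<^sub>1 \<rightarrow> F\<^sub>i\<close> has matrix \<open>diff F i\<close>, and \<open>F\<^sub>0 \<rightarrow> I\<close> maps the basis to the entries of \<open>aug F\<close>.
\<close>

record (overloaded) ('k::zero) graded_complex =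
  shifts :: "nat \<Rightarrow> int list"
  aug :: "'k mpoly vec"
  diff :: "nat \<Rightarrow> 'k mpoly mat"

abbreviation rk :: "'k::zero graded_complex \<Rightarrow> nat \<Rightarrow> nat" where
  "rk F i \<equiv> length (shifts F i)"

definition graded_free_complex :: "nat \<Rightarrow> 'k::field graded_complex \<Rightarrow> bool" where
  "graded_free_complex n F \<longleftrightarrow>
     aug F \<in> free_module n (rk F 0) \<and>
     (\<forall>j<rk F 0. homogeneous (shifts F 0 ! j) (aug F $ j)) \<and>
     (\<forall>i. diff F i \<in> carrier_mat (rk F i) (rk F (i + 1)) \<and>
       (\<forall>j<rk F i. \<forall>k<rk F (i + 1).
          diff F i $$ (j, k) \<in> carrier (poly_ring n) \<and>
          homogeneous (shifts F (i + 1) ! k - shifts F i ! j) (diff F i $$ (j, k))))"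

definition resolves :: "nat \<Rightarrow> 'k::field mpoly set \<Rightarrow> 'k graded_complex \<Rightarrow> bool" where
  "resolves n I F \<longleftrightarrow>
     (\<lambda>v. aug F \<bullet> v) ` free_module n (rk F 0) = I \<and>
     {v \<in> free_module n (rk F 0). aug F \<bullet> v = 0} =
       (\<lambda>v. diff F 0 *\<^sub>v v) ` free_module n (rk F 1) \<and>
     (\<forall>i. {v \<in> free_module n (rk F (i + 1)). diff F i *\<^sub>v v = 0\<^sub>v (rk F i)} =
       (\<lambda>v. diff F (i + 1) *\<^sub>v v) ` free_module n (rk F (i + 2)))"

text \<open>
  Minimality says that the image of \<open>F\<^sub>i\<^sub>+\<^sub>1\<close> lies in \<open>\<mm> F\<^sub>i\<close> for \<open>\<mm> = (x\<^sub>1, \<dots>, x\<^sub>n)\<close>, i.e. that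
  every matrix entry has constant term \<open>0\<close>. No condition is put on \<open>aug F\<close>.
\<close>

definition minimal_graded_free_resolution ::
    "nat \<Rightarrow> 'k::field mpoly set \<Rightarrow> 'k graded_complex \<Rightarrow> bool" where
  "minimal_graded_free_resolution n I F \<longleftrightarrow>
     graded_free_complex n F \<and> resolves n I F \<and>
     (\<forall>i. \<forall>j<rk F i. \<forall>k<rk F (i + 1). Poly_Mapping.lookup (diff F i $$ (j, k)) 0 = 0)"

text \<open>
  The definite description is meaningful for a homogeneous ideal, whose minimal graded free
  resolution exists and is unique up to isomorphism.
\<close>

definition graded_betti :: "nat \<Rightarrow> 'k::field mpoly set \<Rightarrow> nat \<Rightarrow> int \<Rightarrow> nat" where
  "graded_betti n I r d =
     (THE b. \<exists>F. minimal_graded_free_resolution n I F \<and> b = count_list (shifts F r) d)"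


text \<open>The value is \<open>0\<close> for negative \<open>a\<close>, unlike that of the generalized binomial coefficient.\<close>

definition binom :: "int \<Rightarrow> int \<Rightarrow> rat" where
  "binom a b = (if 0 \<le> b \<and> b \<le> a then of_nat (nat a choose nat b) else 0)"

definition kronecker :: "int \<Rightarrow> int \<Rightarrow> rat" where
  "kronecker i j = (if i = j then 1 else 0)"

end

theory Submission
  imports Defs "Jordan_Normal_Form.Determinant"
begin

text \<open>
  Write \<open>Q\<^sub>c\<close> for the ideal generated by \<open>x\<^sub>1 x\<^sub>2\<close> and the products \<open>x\<^sub>j\<^sub>-\<^sub>2 x\<^sub>j\<^sub>-\<^sub>1 x\<^sub>j\<close> with \<open>j \<le> c\<close>.
  Then \<open>Q\<^sub>c : x\<^sub>c\<^sub>-\<^sub>1 x\<^sub>c x\<^sub>c\<^sub>+\<^sub>1 = (x\<^sub>c\<^sub>-\<^sub>2) + Q\<^sub>c\<^sub>-\<^sub>3\<close>, and \<open>NI(P\<^sub>n) = Q\<^sub>n\<^sub>-\<^sub>1 + (x\<^sub>n\<^sub>-\<^sub>1 x\<^sub>n)\<close> with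
  \<open>Q\<^sub>n\<^sub>-\<^sub>1 : x\<^sub>n\<^sub>-\<^sub>1 x\<^sub>n = NI(P\<^sub>n\<^sub>-\<^sub>2)\<close>. In each step the monomial that is added contains a variable \<open>y\<close> that
  does not occur in the smaller ideal, so the comparison map of the mapping cone can be chosen divisible
  by \<open>y\<close>; hence the cone is a minimal resolution, and the graded Betti numbers satisfy a linear
  recursion. Its solution has the generating function
  \<open>1 / (1 - z - t s\<^sup>3 (1 + t s) z\<^sup>4)\<close> as building block; a trinomial revision and a hockey-stick
  summation turn the coefficients into the stated form. The hockey-stick sum is done by the induction
  from \<open>n\<close> to \<open>n + 2\<close>, which exchanges the two parities of \<open>d - r\<close>.
\<close>

section \<open>Polynomials with restricted support\<close>

definition mdeg :: "(nat \<Rightarrow>\<^sub>0 nat) \<Rightarrow> int" where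
  "mdeg m = int (\<Sum>i\<in>Poly_Mapping.keys m. Poly_Mapping.lookup m i)"

lemma mdeg_add: "mdeg (a + b) = mdeg a + mdeg b"
proof -
  let ?K = "Poly_Mapping.keys a \<union> Poly_Mapping.keys b"
  have superset: "mdeg m = int (sum (Poly_Mapping.lookup m) ?K)" if "Poly_Mapping.keys m \<subseteq> ?K" for m
    unfolding mdeg_def
    by (subst sum.mono_neutral_left[OF _ that]) (auto simp: in_keys_iff)
  show ?thesis
    by (simp add: superset Poly_Mapping.keys_add lookup_add sum.distrib)
qed

lemma keys_add_nat: "Poly_Mapping.keys (a + b) = Poly_Mapping.keys a \<union> Poly_Mapping.keys (b :: nat \<Rightarrow>\<^sub>0 nat)"
  by (auto simp: in_keys_iff lookup_add)

text \<open>
  Membership in \<open>K[x\<^sub>1, \<dots>, x\<^sub>n]\<close>, homogeneity, a vanishing constant term and membership in a monomial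
  ideal all have this form.
\<close>

definition supported :: "((nat \<Rightarrow>\<^sub>0 nat) \<Rightarrow> bool) \<Rightarrow> 'k::field mpoly \<Rightarrow> bool" where
  "supported P p \<longleftrightarrow> (\<forall>m\<in>Poly_Mapping.keys p. P m)"

lemma supported_add: "supported P p \<Longrightarrow> supported P q \<Longrightarrow> supported P (p + q)"
  unfolding supported_def using Poly_Mapping.keys_add[of p q] by blast

lemma supported_zero [simp]: "supported P 0"
  by (simp add: supported_def)

lemma supported_uminus [simp]: "supported P (- p) \<longleftrightarrow> supported P p"
  by (simp add: supported_def)

lemma supported_diff: "supported P p \<Longrightarrow> supported P q \<Longrightarrow> supported P (p - q)"
  using supported_add[of P p "- q"] by simp

lemma supported_sum: "(\<And>i. i \<in> A \<Longrightarrow> supported P (f i)) \<Longrightarrow> supported P (sum f A)"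
  by (induction A rule: infinite_finite_induct) (auto intro: supported_add)

lemma supported_mult:
  assumes "supported P p" "supported Q q" "\<And>a b. P a \<Longrightarrow> Q b \<Longrightarrow> T (a + b)"
  shows "supported T (p * q)"
  using assms keys_mult[of p q] unfolding supported_def by fastforce

lemma homogeneous_supported: "homogeneous e = supported (\<lambda>m. mdeg m = e)"
  by (auto simp: homogeneous_def supported_def mdeg_def fun_eq_iff)

lemma carrier_supported: "p \<in> carrier (poly_ring n) \<longleftrightarrow> supported (\<lambda>m. Poly_Mapping.keys m \<subseteq> {1..n}) p"
  by (simp add: poly_ring_def supported_def)

abbreviation R :: "nat \<Rightarrow> 'k::field mpoly set" where "R n \<equiv> carrier (poly_ring n)"

lemma R_closed [simp, intro]:
  "0 \<in> R n" "1 \<in> R n"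
  "p \<in> R n \<Longrightarrow> q \<in> R n \<Longrightarrow> p + q \<in> R n"
  "p \<in> R n \<Longrightarrow> q \<in> R n \<Longrightarrow> p - q \<in> R n"
  "p \<in> R n \<Longrightarrow> - p \<in> R n"
  unfolding carrier_supported by (auto intro: supported_add supported_diff) (auto simp: supported_def)

lemma R_mult [simp, intro]: "p \<in> R n \<Longrightarrow> q \<in> R n \<Longrightarrow> p * q \<in> R n"
  unfolding carrier_supported by (erule supported_mult) (auto simp: keys_add_nat)

lemma R_sum: "(\<And>i. i \<in> A \<Longrightarrow> f i \<in> R n) \<Longrightarrow> sum f A \<in> R n"
  by (auto simp: carrier_supported intro: supported_sum)

lemma homogeneous_mult: "homogeneous d p \<Longrightarrow> homogeneous e q \<Longrightarrow> homogeneous (d + e) (p * q)"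
  unfolding homogeneous_supported by (erule supported_mult) (auto simp: mdeg_add)

section \<open>Constant terms and splitting of polynomials by support\<close>

definition const :: "'k::field mpoly \<Rightarrow> 'k" where
  "const p = Poly_Mapping.lookup p 0"

lemma const_add: "const (p + q) = const p + const q"
  by (simp add: const_def lookup_add)
lemma const_0 [simp]: "const 0 = 0"
  by (simp add: const_def)
lemma const_1 [simp]: "const 1 = 1"
  by (simp add: const_def)
lemma const_diff: "const (p - q) = const p - const q"
  by (simp add: const_def lookup_minus)
lemma const_sum: "const (sum f A) = (\<Sum>i\<in>A. const (f i))"
  by (simp add: const_def lookup_sum)

lemma const_supported: "supported (\<lambda>m. m \<noteq> 0) p \<longleftrightarrow> const p = 0"
  by (auto simp: supported_def const_def in_keys_iff)

lemma const_single_0 [simp]: "const (Poly_Mapping.single 0 c) = c"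
  by (simp add: const_def)

text \<open>A sum of exponent vectors is 0 only if both summands are, so the polynomials without
  constant term absorb products. Splitting the constant off each factor leaves only the product of
  the two constants.\<close>

lemma const_mult: "const ((p :: 'a::field mpoly) * q) = const p * const q"
proof -
  have split: "\<exists>p'. p = Poly_Mapping.single 0 (const p) + p' \<and> const p' = 0" for p :: "'a mpoly"
    by (intro exI[of _ "p - Poly_Mapping.single 0 (const p)"]) (simp add: const_diff)
  have zero: "const (p * q) = 0" if "const p = 0" for p q :: "'a mpoly"
    using that supported_mult[of "\<lambda>m. m \<noteq> 0" p "\<lambda>_. True" q "\<lambda>m. m \<noteq> 0"]
    by (auto simp: const_supported[symmetric]) (auto simp: supported_def poly_mapping_eq_iff lookup_add fun_eq_iff)
  obtain p' where p': "p = Poly_Mapping.single 0 (const p) + p'" "const p' = 0" using split by blast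
  obtain q' where q': "q = Poly_Mapping.single 0 (const q) + q'" "const q' = 0" using split by blast
  have "p * q = Poly_Mapping.single 0 (const p * const q)
      + (p' * q + q' * Poly_Mapping.single 0 (const p))"
    by (subst p'(1), subst q'(1), subst (3) q'(1)) (simp add: algebra_simps mult_single)
  thus ?thesis
    by (simp add: const_add zero p'(2) q'(2))
qed

text \<open>A constant term sits in degree 0. Applied to matrix entries, this makes a
  degree-preserving map block diagonal by degree modulo the variables.\<close>

lemma homogeneous_const: "homogeneous e p \<Longrightarrow> const p \<noteq> 0 \<Longrightarrow> e = 0"
  by (force simp: homogeneous_supported supported_def const_def in_keys_iff mdeg_def)

lemma exists_restriction: "\<exists>p. (\<forall>m. Poly_Mapping.lookup p m = (if P m then Poly_Mapping.lookup (q :: 'k::field mpoly) m else 0))"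
proof -
  have "finite {m. (if P m then Poly_Mapping.lookup q m else 0) \<noteq> 0}"
    by (rule finite_subset[OF _ finite_lookup[of q]]) auto
  thus ?thesis
    by (intro exI[of _ "Abs_poly_mapping (\<lambda>m. if P m then Poly_Mapping.lookup q m else 0)"])
       (simp add: Abs_poly_mapping_inverse)
qed

text \<open>Prepares cancellation arguments: a polynomial supported both in \<open>P\<close> and in
  its complement is 0. The inclusions of keys let both parts inherit further support conditions of
  \<open>q\<close>, such as membership in \<open>R n\<close>.\<close>

lemma supported_split:
  obtains a b where "q = a + b" "supported P a" "supported (\<lambda>m. \<not> P m) b"
    "Poly_Mapping.keys a \<subseteq> Poly_Mapping.keys q" "Poly_Mapping.keys b \<subseteq> Poly_Mapping.keys q"
proof -
  obtain a where a: "\<And>m. Poly_Mapping.lookup a m = (if P m then Poly_Mapping.lookup q m else 0)"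
    using exists_restriction[of P q] by blast
  show ?thesis
    by (rule that[of a "q - a"]) (auto simp: supported_def in_keys_iff a lookup_minus split: if_splits)
qed

lemma homogeneous_split:
  assumes "q \<in> R n"
  obtains p p' where "q = p + p'" "homogeneous e p" "p \<in> R n" "supported (\<lambda>m. mdeg m \<noteq> e) p'"
proof -
  obtain a b where ab: "q = a + b" "supported (\<lambda>m. mdeg m = e) a" "supported (\<lambda>m. \<not> mdeg m = e) b"
      "Poly_Mapping.keys a \<subseteq> Poly_Mapping.keys q"
    by (rule supported_split)
  show ?thesis
    by (rule that[of a b]) (use assms ab in \<open>auto simp: homogeneous_supported carrier_supported supported_def\<close>)
qed

section \<open>Uniqueness of minimal resolutions\<close>

text \<open>If \<open>X\<close> were larger than \<open>Y\<close>, padding both matrices with zeros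
  to squares of size \<open>card X\<close> would make \<open>B' * A'\<close> the identity although
  the last row of \<open>A'\<close> is zero, so a product of determinants would be both 1 and
  0.\<close>

lemma card_le_of_left_inverse:
  fixes A :: "'b \<Rightarrow> 'a \<Rightarrow> 'k::field" and B :: "'a \<Rightarrow> 'b \<Rightarrow> 'k"
  assumes fin: "finite X" "finite Y"
    and inv: "\<And>x x'. x \<in> X \<Longrightarrow> x' \<in> X \<Longrightarrow> (\<Sum>y\<in>Y. B x y * A y x') = (if x = x' then 1 else 0)"
  shows "card X \<le> card Y"
proof (rule ccontr)
  define N M where "N = card X" and "M = card Y"
  assume "\<not> card X \<le> card Y"
  hence less: "M < N" by (simp add: N_def M_def)
  obtain g where g: "bij_betw g {0..<N} X" using ex_bij_betw_nat_finite[OF fin(1)] N_def by blast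
  obtain f where f: "bij_betw f {0..<M} Y" using ex_bij_betw_nat_finite[OF fin(2)] M_def by blast
  define B' where "B' = mat N N (\<lambda>(i, j). if j < M then B (g i) (f j) else 0)"
  define A' where "A' = mat N N (\<lambda>(i, j). if i < M then A (f i) (g j) else 0)"
  have carr: "A' \<in> carrier_mat N N" "B' \<in> carrier_mat N N" by (simp_all add: A'_def B'_def)
  have "B' * A' = 1\<^sub>m N"
  proof (rule eq_matI)
    fix i j assume ij: "i < dim_row (1\<^sub>m N :: 'k mat)" "j < dim_col (1\<^sub>m N :: 'k mat)"
    have "(B' * A') $$ (i, j) = (\<Sum>y\<in>{0..<N}. if y < M then B (g i) (f y) * A (f y) (g j) else 0)"
      using ij by (auto simp: B'_def A'_def scalar_prod_def intro!: sum.cong)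
    also have "\<dots> = (\<Sum>y\<in>{0..<M}. B (g i) (f y) * A (f y) (g j))"
      using less by (intro sum.mono_neutral_cong_right) auto
    also have "\<dots> = (\<Sum>y\<in>Y. B (g i) y * A y (g j))"
      by (rule sum.reindex_bij_betw[OF f])
    also have "\<dots> = (if g i = g j then 1 else 0)"
      using ij g by (intro inv) (auto simp: bij_betw_def)
    also have "\<dots> = 1\<^sub>m N $$ (i, j)"
      using ij g by (auto simp: bij_betw_def inj_on_def)
    finally show "(B' * A') $$ (i, j) = 1\<^sub>m N $$ (i, j)" .
  qed (simp_all add: A'_def B'_def)
  hence "det B' * det A' = 1"
    using det_mult[OF carr(2) carr(1)] by simp
  moreover have "A' = mat\<^sub>r N N (\<lambda>i. if i = N - 1 then 0\<^sub>v N else row A' i)"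
    using less by (intro eq_matI) (auto simp: A'_def)
  moreover have "det (mat\<^sub>r N N (\<lambda>i. if i = N - 1 then 0\<^sub>v N else row A' i)) = 0"
    using less carr by (intro det_row_0) auto
  ultimately show False by simp
qed

section \<open>Matrices of degree-preserving maps\<close>

text \<open>A degree-preserving map from the sum of the R(-e) with \<open>e\<close> in
  \<open>t\<close> to the corresponding sum for \<open>s\<close>: rows belong to the target, columns
  to the source.\<close>

definition gmat :: "nat \<Rightarrow> int list \<Rightarrow> int list \<Rightarrow> 'k::field mpoly mat \<Rightarrow> bool" where
  "gmat n s t M \<longleftrightarrow> M \<in> carrier_mat (length s) (length t) \<and>
     (\<forall>j<length s. \<forall>k<length t. M $$ (j, k) \<in> R n \<and> homogeneous (t ! k - s ! j) (M $$ (j, k)))"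

lemma gmat_carrier [dest]: "gmat n s t M \<Longrightarrow> M \<in> carrier_mat (length s) (length t)"
  by (simp add: gmat_def)

lemma gmatD:
  assumes "gmat n s t M" "j < length s" "k < length t"
  shows "M $$ (j, k) \<in> R n" "homogeneous (t ! k - s ! j) (M $$ (j, k))"
  using assms by (simp_all add: gmat_def)

lemma gmat_mult:
  assumes "gmat n s t M" "gmat n t u N"
  shows "gmat n s u (M * N)"
proof -
  have "homogeneous (u ! k - s ! i) (M $$ (i, j) * N $$ (j, k))"
    if "i < length s" "j < length t" "k < length u" for i j k
    using homogeneous_mult[of "t ! j - s ! i" "M $$ (i, j)" "u ! k - t ! j" "N $$ (j, k)"] assms that
    by (simp add: gmat_def)
  thus ?thesis using assms
    by (auto simp: gmat_def scalar_prod_def homogeneous_supported intro!: R_sum supported_sum)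
qed

lemma gmat_diff: "gmat n s t M \<Longrightarrow> gmat n s t N \<Longrightarrow> gmat n s t (M - N)"
  by (auto simp: gmat_def homogeneous_supported intro!: supported_diff)

lemma gmat_uminus: "gmat n s t M \<Longrightarrow> gmat n s t (- M)"
  by (auto simp: gmat_def homogeneous_supported)

lemma gmat_zero: "gmat n s t (0\<^sub>m (length s) (length t))"
  by (auto simp: gmat_def homogeneous_supported)

lemma gmat_one: "gmat n s s (1\<^sub>m (length s))"
  by (auto simp: gmat_def homogeneous_supported supported_def mdeg_def)

lemma free_moduleD: "v \<in> free_module n s \<Longrightarrow> v \<in> carrier_vec s"
  by (simp add: free_module_def)

lemma col_free_module: "gmat n s t M \<Longrightarrow> k < length t \<Longrightarrow> col M k \<in> free_module n (length s)"
  by (auto simp: gmat_def free_module_def)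

lemma free_module_closed:
  "0\<^sub>v s \<in> free_module n s"
  "v \<in> free_module n s \<Longrightarrow> w \<in> free_module n s \<Longrightarrow> v + w \<in> free_module n s"
  "v \<in> free_module n s \<Longrightarrow> w \<in> free_module n s \<Longrightarrow> v - w \<in> free_module n s"
  "v \<in> free_module n s \<Longrightarrow> - v \<in> free_module n s"
  by (auto simp: free_module_def)

lemma gmat_mult_vec:
  "gmat n s t M \<Longrightarrow> v \<in> free_module n (length t) \<Longrightarrow> M *\<^sub>v v \<in> free_module n (length s)"
  by (auto simp: gmat_def free_module_def scalar_prod_def intro!: R_sum)

text \<open>Arbitrary preimages of the columns are made homogeneous by keeping in each entry only
  the component of the required degree. The discarded components contribute to the product only in
  other degrees, whereas \<open>V - M * W\<close> is homogeneous of the required degree, so the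
  difference vanishes.\<close>

lemma gmat_factor:
  assumes V: "gmat n s u V" and M: "gmat n s t M"
    and im: "\<And>k. k < length u \<Longrightarrow> col V k \<in> (\<lambda>v. M *\<^sub>v v) ` free_module n (length t)"
  obtains W where "gmat n t u W" "M * W = V"
proof -
  have "\<exists>a b. w $ j = a + b \<and> homogeneous (u ! k - t ! j) a \<and> a \<in> R n \<and>
      supported (\<lambda>m. mdeg m \<noteq> u ! k - t ! j) b"
    if "w \<in> free_module n (length t)" "j < length t" for w :: "'a mpoly vec" and j k
  proof -
    have "w $ j \<in> R n" using that by (simp add: free_module_def)
    from homogeneous_split[OF this, of "u ! k - t ! j"] show ?thesis by metis
  qed
  note split = this
  have "\<forall>k. \<exists>w. k < length u \<longrightarrow> w \<in> free_module n (length t) \<and> col V k = M *\<^sub>v w"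
    using im by (auto simp: image_iff)
  then obtain w where w: "\<And>k. k < length u \<Longrightarrow> w k \<in> free_module n (length t)"
      "\<And>k. k < length u \<Longrightarrow> col V k = M *\<^sub>v w k"
    using choice[of "\<lambda>k w. k < length u \<longrightarrow> w \<in> free_module n (length t) \<and> col V k = M *\<^sub>v w"] by auto
  define Q where "Q k j a b \<longleftrightarrow> w k $ j = a + b \<and> homogeneous (u ! k - t ! j) a \<and> a \<in> R n \<and>
      supported (\<lambda>m. mdeg m \<noteq> u ! k - t ! j) b" for k j a b
  have "\<forall>k j. \<exists>a b. k < length u \<longrightarrow> j < length t \<longrightarrow> Q k j a b"
    unfolding Q_def using split w(1) by blast
  then obtain a b where "\<And>k j. k < length u \<Longrightarrow> j < length t \<Longrightarrow> Q k j (a k j) (b k j)"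
    by metis
  note ab = this[unfolded Q_def]
  define W where "W = mat (length t) (length u) (\<lambda>(j, k). a k j)"
  have W: "gmat n t u W" using ab by (auto simp: gmat_def W_def)
  have "M * W = V"
  proof (rule eq_matI)
    fix i k assume "i < dim_row V" "k < dim_col V"
    hence ik: "i < length s" "k < length u" using V by (auto simp: gmat_def)
    let ?J = "{0..<length t}" and ?e = "u ! k - s ! i"
    have dim: "dim_vec (w k) = length t"
      using w(1)[OF ik(2)] by (simp add: free_module_def)
    have "V $$ (i, k) = col V k $ i"
      using ik V by (auto simp: gmat_def)
    also have "\<dots> = (\<Sum>j\<in>?J. M $$ (i, j) * (a k j + b k j))"
      unfolding w(2)[OF ik(2)] using ik M ab dim by (auto simp: gmat_def scalar_prod_def intro!: sum.cong)
    finally have eq: "V $$ (i, k) - (M * W) $$ (i, k) = (\<Sum>j\<in>?J. M $$ (i, j) * b k j)"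
      using ik carrier_matD[OF gmat_carrier[OF M]]
      by (simp add: W_def scalar_prod_def distrib_left sum.distrib)
    have "homogeneous ?e (V $$ (i, k) - (M * W) $$ (i, k))"
      using V gmat_mult[OF M W] ik by (auto simp: gmat_def homogeneous_supported intro: supported_diff)
    moreover have "supported (\<lambda>m. mdeg m \<noteq> ?e) (\<Sum>j\<in>?J. M $$ (i, j) * b k j)"
    proof (rule supported_sum)
      fix j assume j: "j \<in> ?J"
      have "supported (\<lambda>m. mdeg m = t ! j - s ! i) (M $$ (i, j))"
        using M ik j by (simp add: gmat_def homogeneous_supported)
      thus "supported (\<lambda>m. mdeg m \<noteq> ?e) (M $$ (i, j) * b k j)"
        by (rule supported_mult[where Q = "\<lambda>m. mdeg m \<noteq> u ! k - t ! j"]) (use ab ik j in \<open>auto simp: mdeg_add\<close>)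
    qed
    ultimately have "Poly_Mapping.keys (V $$ (i, k) - (M * W) $$ (i, k)) = {}"
      unfolding eq homogeneous_supported supported_def by blast
    thus "(M * W) $$ (i, k) = V $$ (i, k)" by simp
  qed (use M V in \<open>auto simp: gmat_def W_def\<close>)
  with W that show ?thesis by blast
qed

section \<open>Exact complexes and the comparison theorem\<close>

text \<open>Exactness is required at the positions from 1 on, so the complex resolves the cokernel
  of \<open>D 0\<close>.\<close>

definition exact :: "nat \<Rightarrow> (nat \<Rightarrow> int list) \<Rightarrow> (nat \<Rightarrow> 'k::field mpoly mat) \<Rightarrow> bool" where
  "exact n S D \<longleftrightarrow> (\<forall>i. gmat n (S i) (S (Suc i)) (D i)) \<and>
     (\<forall>i. {v \<in> free_module n (length (S (Suc i))). D i *\<^sub>v v = 0\<^sub>v (length (S i))} =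
        (\<lambda>v. D (Suc i) *\<^sub>v v) ` free_module n (length (S (Suc (Suc i)))))"

lemma exact_gmat: "exact n S D \<Longrightarrow> gmat n (S i) (S (Suc i)) (D i)"
  by (simp add: exact_def)

lemma exact_ker:
  "exact n S D \<Longrightarrow> v \<in> free_module n (length (S (Suc i))) \<Longrightarrow> D i *\<^sub>v v = 0\<^sub>v (length (S i)) \<Longrightarrow>
    v \<in> (\<lambda>v. D (Suc i) *\<^sub>v v) ` free_module n (length (S (Suc (Suc i))))"
  unfolding exact_def by blast

lemma mult_eq_0_iff_vec:
  fixes M :: "'k::field mpoly mat"
  assumes "M \<in> carrier_mat a b" "N \<in> carrier_mat b c"
  shows "M * N = 0\<^sub>m a c \<longleftrightarrow> (\<forall>k<c. M *\<^sub>v col N k = 0\<^sub>v a)"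
proof
  assume "M * N = 0\<^sub>m a c"
  thus "\<forall>k<c. M *\<^sub>v col N k = 0\<^sub>v a"
    by (simp add: col_mult2[OF assms, symmetric])
next
  assume "\<forall>k<c. M *\<^sub>v col N k = 0\<^sub>v a"
  thus "M * N = 0\<^sub>m a c" using assms
    by (intro mat_col_eqI) (auto simp: col_mult2)
qed

lemma exact_comp_vec:
  assumes "exact n S D" "v \<in> free_module n (length (S (Suc (Suc i))))"
  shows "D i *\<^sub>v (D (Suc i) *\<^sub>v v) = 0\<^sub>v (length (S i))"
  using assms unfolding exact_def by blast

lemma unit_vec_free: "k < s \<Longrightarrow> unit_vec s k \<in> free_module n s"
  by (auto simp: free_module_def unit_vec_def)

lemma mult_mat_swap:
  fixes A :: "'a::semiring_0 mat"
  assumes "A * B = C * X" "A \<in> carrier_mat a b" "B \<in> carrier_mat b c" "C \<in> carrier_mat a b'"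
    "X \<in> carrier_mat b' c" "Y \<in> carrier_mat c d"
  shows "A * (B * Y) = C * (X * Y)"
  using assms(1) assoc_mult_mat[OF assms(2,3,6)] assoc_mult_mat[OF assms(4,5,6)] by simp

lemma mult_unit_vec_col:
  "(M :: 'a::semiring_1 mat) \<in> carrier_mat a b \<Longrightarrow> k < b \<Longrightarrow> M *\<^sub>v unit_vec b k = col M k"
  by (intro eq_vecI) auto

lemma exact_comp:
  assumes "exact n S D"
  shows "D i * D (Suc i) = 0\<^sub>m (length (S i)) (length (S (Suc (Suc i))))"
proof (subst mult_eq_0_iff_vec)
  show "D i \<in> carrier_mat (length (S i)) (length (S (Suc i)))"
    "D (Suc i) \<in> carrier_mat (length (S (Suc i))) (length (S (Suc (Suc i))))"
    using exact_gmat[OF assms] by blast+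
  thus "\<forall>k<length (S (Suc (Suc i))). D i *\<^sub>v col (D (Suc i)) k = 0\<^sub>v (length (S i))"
    using exact_comp_vec[OF assms unit_vec_free, of _ i]
    using mult_unit_vec_col[OF gmat_carrier[OF exact_gmat[OF assms]]] by fastforce
qed

text \<open>Lifting from a graded free source: the columns of \<open>V\<close> are cycles, hence
  boundaries, and \<open>gmat_factor\<close> chooses their preimages compatibly with the
  degrees.\<close>

lemma exact_factor:
  assumes ex: "exact n S D" and V: "gmat n (S (Suc i)) u V" and 0: "D i * V = 0\<^sub>m (length (S i)) (length u)"
  obtains W where "gmat n (S (Suc (Suc i))) u W" "D (Suc i) * W = V"
proof (rule gmat_factor[OF V exact_gmat[OF ex]])
  fix k assume k: "k < length u"
  show "col V k \<in> (\<lambda>v. D (Suc i) *\<^sub>v v) ` free_module n (length (S (Suc (Suc i))))"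
  proof (rule exact_ker[OF ex col_free_module[OF V k]])
    show "D i *\<^sub>v col V k = 0\<^sub>v (length (S i))"
      using 0 k mult_eq_0_iff_vec[OF gmat_carrier[OF exact_gmat[OF ex]] gmat_carrier[OF V]] by blast
  qed
qed

text \<open>The comparison theorem: composing the latest map with the source differential gives
  cycles in the target, which lift through the next differential. At the bottom, where exactness
  says nothing, \<open>im\<close> starts the lifting.\<close>

lemma chain_map_lift:
  fixes E :: "nat \<Rightarrow> 'k::field mpoly mat"
  assumes D: "exact n S D" and E: "exact n T E"
    and \<phi>0: "gmat n (T 0) (S 0) \<phi>0"
    and im: "\<And>k. k < length (S (Suc 0)) \<Longrightarrow> col (\<phi>0 * D 0) k \<in> (\<lambda>v. E 0 *\<^sub>v v) ` free_module n (length (T (Suc 0)))"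
  obtains \<phi> where "\<phi> 0 = \<phi>0" "\<And>i. gmat n (T i) (S i) (\<phi> i)" "\<And>i. \<phi> i * D i = E i * \<phi> (Suc i)"
proof -
  note gD = exact_gmat[OF D] and gE = exact_gmat[OF E]
  note c = gmat_carrier[OF gD] gmat_carrier[OF gE]
  \<comment> \<open>The condition on \<open>f\<close> already includes a completed next square, so
    whatever is chosen can be continued and dependent choice applies.\<close>
  define P where "P i f \<longleftrightarrow> gmat n (T i) (S i) f \<and> (i = 0 \<longrightarrow> f = \<phi>0) \<and>
     (\<exists>g. gmat n (T (Suc i)) (S (Suc i)) g \<and> f * D i = E i * g)" for i f
  obtain \<phi>1 where "gmat n (T (Suc 0)) (S (Suc 0)) \<phi>1" "E 0 * \<phi>1 = \<phi>0 * D 0"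
    using gmat_factor[OF gmat_mult[OF \<phi>0 gD] gE im] by blast
  hence base: "P 0 \<phi>0" using \<phi>0 by (auto simp: P_def)
  have step: "\<exists>g. P (Suc i) g \<and> f * D i = E i * g" if "P i f" for i f
  proof -
    from that obtain g where f: "gmat n (T i) (S i) f" and g: "gmat n (T (Suc i)) (S (Suc i)) g" "f * D i = E i * g"
      by (auto simp: P_def)
    note cc = gmat_carrier[OF f] gmat_carrier[OF g(1)]
    have "E i * (g * D (Suc i)) = f * (D i * D (Suc i))"
      by (rule mult_mat_swap[OF g(2)[symmetric] c(2) cc(2) cc(1) c(1) c(1)])
    also have "\<dots> = 0\<^sub>m (length (T i)) (length (S (Suc (Suc i))))"
      using cc by (simp add: exact_comp[OF D])
    finally obtain h where "gmat n (T (Suc (Suc i))) (S (Suc (Suc i))) h" "E (Suc i) * h = g * D (Suc i)"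
      using exact_factor[OF E gmat_mult[OF g(1) gD]] by blast
    hence "P (Suc i) g" using g by (auto simp: P_def)
    with g show ?thesis by blast
  qed
  obtain \<phi> where "\<And>i. P i (\<phi> i)" "\<And>i. \<phi> i * D i = E i * \<phi> (Suc i)"
    using dependent_nat_choice[of P "\<lambda>i f g. f * D i = E i * g"] base step by metis
  thus ?thesis using that[of \<phi>] by (auto simp: P_def)
qed

section \<open>Minimality and comparison of Betti numbers\<close>

definition min_mat :: "'k::field mpoly mat \<Rightarrow> bool" where
  "min_mat M \<longleftrightarrow> (\<forall>i<dim_row M. \<forall>j<dim_col M. const (M $$ (i, j)) = 0)"

lemma min_mat_mult:
  assumes "min_mat M \<or> min_mat N" "M \<in> carrier_mat a b" "N \<in> carrier_mat b c"
  shows "min_mat (M * N)"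
  using assms by (auto simp: min_mat_def scalar_prod_def const_sum const_mult intro!: sum.neutral)

lemma min_mat_add:
  "min_mat M \<Longrightarrow> min_mat N \<Longrightarrow> M \<in> carrier_mat a b \<Longrightarrow> N \<in> carrier_mat a b \<Longrightarrow> min_mat (M + N)"
  by (auto simp: min_mat_def const_add)

text \<open>
  \<open>\<chi>\<close> is null-homotopic via some \<open>h\<close> with \<open>h\<^sub>0 = 0\<close>, so \<open>\<chi>\<^sub>i = D\<^sub>i h\<^sub>i + h\<^sub>i\<^sub>-\<^sub>1 D\<^sub>i\<^sub>-\<^sub>1\<close> vanishes modulo the variables.
  The choice \<open>h\<^sub>0 = 0\<close> is why nothing is required of \<open>D 0\<close>.
\<close>

lemma null_homotopic_min_mat:
  fixes D :: "nat \<Rightarrow> 'k::field mpoly mat"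
  assumes D: "exact n S D" and min: "\<And>i. min_mat (D (Suc i))"
    and \<chi>: "\<And>i. gmat n (S i) (S i) (\<chi> i)" "\<And>i. \<chi> i * D i = D i * \<chi> (Suc i)"
    and \<chi>0: "\<chi> 0 = 0\<^sub>m (length (S 0)) (length (S 0))"
  shows "min_mat (\<chi> i)"
proof -
  note gD = exact_gmat[OF D]
  note c = gmat_carrier[OF gD] gmat_carrier[OF \<chi>(1)]
  \<comment> \<open>The last conjunct says that the error left by \<open>h\<close> consists of
    cycles, which is what makes the next homotopy map exist.\<close>
  define P where "P i h \<longleftrightarrow> gmat n (S (Suc i)) (S i) h \<and> (i = 0 \<longrightarrow> min_mat h) \<and>
      D i * (\<chi> (Suc i) - h * D i) = 0\<^sub>m (length (S i)) (length (S (Suc i)))" for i h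
  have base: "P 0 (0\<^sub>m (length (S (Suc 0))) (length (S 0)))"
  proof -
    have "D 0 * (\<chi> (Suc 0) - 0\<^sub>m (length (S (Suc 0))) (length (S 0)) * D 0) = \<chi> 0 * D 0"
      unfolding left_mult_zero_mat[OF c(1)] \<chi>(2)[of 0]
      by (rule arg_cong[where f = "\<lambda>M. D 0 * M"]) (use c(2)[of "Suc 0"] in \<open>auto intro!: eq_matI\<close>)
    thus ?thesis using c[of 0] by (simp add: P_def gmat_zero \<chi>0 min_mat_def)
  qed
  have step: "\<exists>h'. P (Suc i) h' \<and> D (Suc i) * h' = \<chi> (Suc i) - h * D i" if "P i h" for i h
  proof -
    from that have h: "gmat n (S (Suc i)) (S i) h"
      and z: "D i * (\<chi> (Suc i) - h * D i) = 0\<^sub>m (length (S i)) (length (S (Suc i)))"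
      by (simp_all add: P_def)
    note ch = gmat_carrier[OF h]
    obtain h' where h': "gmat n (S (Suc (Suc i))) (S (Suc i)) h'" "D (Suc i) * h' = \<chi> (Suc i) - h * D i"
      using exact_factor[OF D gmat_diff[OF \<chi>(1) gmat_mult[OF h gD]] z] by blast
    note ch' = gmat_carrier[OF h'(1)]
    let ?D = "D (Suc i)"
    have "?D * (\<chi> (Suc (Suc i)) - h' * ?D) = ?D * \<chi> (Suc (Suc i)) - ?D * (h' * ?D)"
      by (rule mult_minus_distrib_mat[OF c(1) c(2) mult_carrier_mat[OF ch' c(1)]])
    also have "?D * (h' * ?D) = (\<chi> (Suc i) - h * D i) * ?D"
      unfolding h'(2)[symmetric] by (rule assoc_mult_mat[OF c(1) ch' c(1), symmetric])
    also have "\<dots> = \<chi> (Suc i) * ?D - h * D i * ?D"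
      by (rule minus_mult_distrib_mat[OF c(2) mult_carrier_mat[OF ch c(1)] c(1)])
    also have "h * D i * ?D = h * (D i * ?D)"
      by (rule assoc_mult_mat[OF ch c(1) c(1)])
    also have "\<dots> = 0\<^sub>m (length (S (Suc i))) (length (S (Suc (Suc i))))"
      using ch by (simp add: exact_comp[OF D])
    finally have "?D * (\<chi> (Suc (Suc i)) - h' * ?D) = 0\<^sub>m (length (S (Suc i))) (length (S (Suc (Suc i))))"
      using mult_carrier_mat[OF c(1) c(2)[of "Suc (Suc i)"]] unfolding \<chi>(2)[of "Suc i"]
      by (auto intro!: eq_matI)
    with h' show ?thesis by (auto simp: P_def)
  qed
  obtain h where h: "\<And>i. P i (h i)" "\<And>i. D (Suc i) * h (Suc i) = \<chi> (Suc i) - h i * D i"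
    using dependent_nat_choice[of P "\<lambda>i h h'. D (Suc i) * h' = \<chi> (Suc i) - h * D i"] base step by metis
  show ?thesis
  proof (cases i)
    case 0
    thus ?thesis by (simp add: \<chi>0 min_mat_def)
  next
    case (Suc j)
    have ch: "h i \<in> carrier_mat (length (S (Suc i))) (length (S i))" for i
      using h(1)[of i] by (auto simp: P_def)
    have "\<chi> (Suc j) = D (Suc j) * h (Suc j) + h j * D j"
      unfolding h(2) using c(1)[of j] c(2)[of "Suc j"] ch[of j] by (intro eq_matI) auto
    moreover have "min_mat (D (Suc j) * h (Suc j))"
      by (rule min_mat_mult[OF _ c(1) ch]) (use min in auto)
    \<comment> \<open>For \<open>j = 0\<close> the factor \<open>h 0\<close> has no constant terms,
      for \<open>j > 0\<close> the factor \<open>D j\<close> has none.\<close>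
    moreover have "min_mat (h j * D j)"
      by (rule min_mat_mult[OF _ ch c(1)]) (use min h(1)[of j] in \<open>cases j; auto simp: P_def\<close>)
    ultimately show ?thesis
      unfolding Suc using c ch by (metis min_mat_add mult_carrier_mat)
  qed
qed

lemma count_list_card: "count_list xs d = card {k. k < length xs \<and> xs ! k = d}"
  by (simp add: count_list_eq_length_filter length_filter_conv_card eq_commute)

text \<open>Lifting the identity both ways gives chain maps \<open>\<phi>\<close> and
  \<open>\<psi>\<close>. The difference of the identity and \<open>\<psi> \<phi>\<close> starts with
  0, so it vanishes modulo the variables. The constant terms of \<open>\<psi>\<close> and
  \<open>\<phi>\<close>, restricted to shift \<open>d\<close>, are thus matrices with product 1,
  which bounds the number of such shifts.\<close>

lemma count_list_le_of_resolutions: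
  fixes D :: "nat \<Rightarrow> 'k::field mpoly mat"
  assumes D: "exact n S D" and E: "exact n T E" and min: "\<And>i. min_mat (D (Suc i))"
    and ST: "S 0 = T 0"
    and im: "(\<lambda>v. D 0 *\<^sub>v v) ` free_module n (length (S (Suc 0))) = (\<lambda>v. E 0 *\<^sub>v v) ` free_module n (length (T (Suc 0)))"
  shows "count_list (S i) d \<le> count_list (T i) d"
proof -
  let ?I = "\<lambda>i. 1\<^sub>m (length (S i)) :: 'k mpoly mat"
  note gD = exact_gmat[OF D] and gE = exact_gmat[OF E]
  note c = gmat_carrier[OF gD] gmat_carrier[OF gE]
  have lift: "col (1\<^sub>m (length (S 0)) * M) k \<in> (\<lambda>v. N *\<^sub>v v) ` free_module n (length t)"
    if "M \<in> carrier_mat (length (S 0)) (length s)" "k < length s"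
      "(\<lambda>v. M *\<^sub>v v) ` free_module n (length s) = (\<lambda>v. N *\<^sub>v v) ` free_module n (length t)"
    for M N :: "'k mpoly mat" and s t k
    using that imageI[OF unit_vec_free[OF that(2)], of "\<lambda>v. M *\<^sub>v v" n]
    by (simp only: mult_unit_vec_col[OF that(1,2)] left_mult_one_mat[OF that(1)])
  have g1: "gmat n (T 0) (S 0) (?I 0)" "gmat n (S 0) (T 0) (?I 0)" using gmat_one ST by metis+
  obtain \<phi> where \<phi>: "\<phi> 0 = ?I 0" "\<And>i. gmat n (T i) (S i) (\<phi> i)" "\<And>i. \<phi> i * D i = E i * \<phi> (Suc i)"
    using chain_map_lift[OF D E g1(1) lift[OF c(1) _ im]] by blast
  obtain \<psi> where \<psi>: "\<psi> 0 = ?I 0" "\<And>i. gmat n (S i) (T i) (\<psi> i)" "\<And>i. \<psi> i * E i = D i * \<psi> (Suc i)"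
    using chain_map_lift[OF E D g1(2) lift[OF c(2)[of 0, folded ST] _ im[symmetric]]] by blast
  note c' = c gmat_carrier[OF \<phi>(2)] gmat_carrier[OF \<psi>(2)]
  define \<chi> where "\<chi> i = ?I i - \<psi> i * \<phi> i" for i
  have min\<chi>: "min_mat (\<chi> i)" for i
  proof (rule null_homotopic_min_mat[OF D min])
    show "gmat n (S i) (S i) (\<chi> i)" for i
      unfolding \<chi>_def by (intro gmat_diff gmat_one gmat_mult[OF \<psi>(2) \<phi>(2)])
    show "\<chi> 0 = 0\<^sub>m (length (S 0)) (length (S 0))"
      by (simp add: \<chi>_def \<phi>(1) \<psi>(1))
    fix i
    have "\<chi> i * D i = D i - \<psi> i * \<phi> i * D i"
      unfolding \<chi>_def minus_mult_distrib_mat[OF one_carrier_mat mult_carrier_mat[OF c'(4) c'(3)] c'(1)]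
        left_mult_one_mat[OF c'(1)] ..
    also have "\<psi> i * \<phi> i * D i = \<psi> i * (E i * \<phi> (Suc i))"
      unfolding \<phi>(3)[symmetric] by (rule assoc_mult_mat[OF c'(4) c'(3) c'(1)])
    also have "\<dots> = D i * (\<psi> (Suc i) * \<phi> (Suc i))"
      by (rule mult_mat_swap[OF \<psi>(3) c'(4) c'(2) c'(1) c'(4) c'(3)])
    also have "D i - \<dots> = D i * \<chi> (Suc i)"
      unfolding \<chi>_def mult_minus_distrib_mat[OF c'(1) one_carrier_mat mult_carrier_mat[OF c'(4) c'(3)]]
        right_mult_one_mat[OF c'(1)] ..
    finally show "\<chi> i * D i = D i * \<chi> (Suc i)" .
  qed
  let ?X = "{k. k < length (S i) \<and> S i ! k = d}" and ?Y = "{k. k < length (T i) \<and> T i ! k = d}"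
  let ?A = "\<lambda>j k. const (\<phi> i $$ (j, k))" and ?B = "\<lambda>k j. const (\<psi> i $$ (k, j))"
  have "card ?X \<le> card ?Y"
  proof (rule card_le_of_left_inverse[where A = ?A and B = ?B])
    fix x x' assume x: "x \<in> ?X" "x' \<in> ?X"
    have "const (\<chi> i $$ (x, x')) = 0"
      using min\<chi>[of i] c'(3)[of i] c'(4)[of i] x by (auto simp: min_mat_def \<chi>_def)
    hence "(if x = x' then 1 else 0) = (\<Sum>y\<in>{0..<length (T i)}. ?B x y * ?A y x')"
      using x c'(3)[of i] c'(4)[of i] by (simp add: \<chi>_def const_diff scalar_prod_def const_sum const_mult split: if_splits)
    \<comment> \<open>An entry of \<open>\<phi> i\<close> joining shift \<open>d\<close> to another
      shift is homogeneous of nonzero degree and has no constant term, so only the block of shift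
      \<open>d\<close> contributes.\<close>
    also have "\<dots> = (\<Sum>y\<in>?Y. ?B x y * ?A y x')"
    proof (intro sum.mono_neutral_right ballI)
      fix y assume y: "y \<in> {0..<length (T i)} - ?Y"
      have "homogeneous (S i ! x' - T i ! y) (\<phi> i $$ (y, x'))"
        by (rule gmatD(2)[OF \<phi>(2)]) (use x y in auto)
      hence "?A y x' = 0" using homogeneous_const x y by fastforce
      thus "?B x y * ?A y x' = 0" by simp
    qed auto
    finally show "(\<Sum>y\<in>?Y. ?B x y * ?A y x') = (if x = x' then 1 else 0)" ..
  qed auto
  thus ?thesis by (simp add: count_list_card)
qed

section \<open>Mapping cones\<close>

text \<open>
  Resolutions of the quotient by \<open>J\<close> instead of \<open>J\<close>: the augmentation becomes the zeroth differential, so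
  the homological degrees are one higher than those of \<open>graded_betti\<close>.
\<close>

definition res :: "nat \<Rightarrow> 'k::field mpoly set \<Rightarrow> (nat \<Rightarrow> int list) \<Rightarrow> (nat \<Rightarrow> 'k mpoly mat) \<Rightarrow> bool" where
  "res n J S D \<longleftrightarrow> exact n S D \<and> S 0 = [0] \<and> (\<forall>i. min_mat (D i)) \<and>
     (\<lambda>v. (D 0 *\<^sub>v v) $ 0) ` free_module n (length (S (Suc 0))) = J"

lemma image_vec_1:
  assumes "M \<in> carrier_mat 1 b"
  shows "(\<lambda>v. M *\<^sub>v v) ` A = (\<lambda>p. vec 1 (\<lambda>_. p)) ` (\<lambda>v. (M *\<^sub>v v) $ 0) ` A"
proof -
  have eq: "M *\<^sub>v v = vec 1 (\<lambda>_. (M *\<^sub>v v) $ 0)" for v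
    using assms by (intro eq_vecI) auto
  show ?thesis unfolding image_image by (rule image_cong[OF refl eq])
qed

text \<open>Prepending R, with the augmentation as a one-row matrix, turns \<open>F\<close> into an
  exact complex that starts like \<open>S\<close>. The comparison then applies in both
  directions.\<close>

lemma count_list_minimal_resolution:
  assumes res: "res n J S D" and F: "minimal_graded_free_resolution n J F"
  shows "count_list (shifts F r) d = count_list (S (Suc r)) d"
proof -
  define T where "T = case_nat [0] (shifts F)"
  define E where "E = case_nat (mat 1 (rk F 0) (\<lambda>(_, k). aug F $ k)) (diff F)"
  have ind: "T 0 = [0]" "T (Suc i) = shifts F i" "E (Suc i) = diff F i" for i
    by (simp_all add: T_def E_def)
  have F: "graded_free_complex n F" "resolves n J F"
      "\<And>i j k. j < rk F i \<Longrightarrow> k < rk F (Suc i) \<Longrightarrow> const (diff F i $$ (j, k)) = 0"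
    using F by (auto simp: minimal_graded_free_resolution_def const_def)
  have aug: "aug F \<in> carrier_vec (rk F 0)"
    using F(1) by (simp add: graded_free_complex_def free_module_def)
  have E0: "(E 0 *\<^sub>v v) $ 0 = aug F \<bullet> v" "E 0 *\<^sub>v v = 0\<^sub>v (Suc 0) \<longleftrightarrow> aug F \<bullet> v = 0"
    if "v \<in> free_module n (rk F 0)" for v
  proof -
    have "row (E 0) 0 = aug F" using aug by (auto simp: E_def)
    thus *: "(E 0 *\<^sub>v v) $ 0 = aug F \<bullet> v" by (simp add: E_def)
    thus "E 0 *\<^sub>v v = 0\<^sub>v (Suc 0) \<longleftrightarrow> aug F \<bullet> v = 0"
      by (auto simp: E_def vec_eq_iff)
  qed
  have "gmat n (T i) (T (Suc i)) (E i)" for i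
    using F(1) by (cases i) (auto simp: gmat_def ind E_def graded_free_complex_def free_module_def)
  moreover have "{v \<in> free_module n (length (T (Suc i))). E i *\<^sub>v v = 0\<^sub>v (length (T i))} =
        (\<lambda>v. E (Suc i) *\<^sub>v v) ` free_module n (length (T (Suc (Suc i))))" for i
    using F(2) E0 by (cases i) (auto simp: ind resolves_def cong: conj_cong)
  ultimately have E: "exact n T E" by (simp add: exact_def)
  have D: "exact n S D" and S0: "S 0 = [0]" and minD: "\<And>i. min_mat (D i)"
    and imD: "(\<lambda>v. (D 0 *\<^sub>v v) $ 0) ` free_module n (length (S (Suc 0))) = J"
    using res by (auto simp: res_def)
  have "(\<lambda>v. (E 0 *\<^sub>v v) $ 0) ` free_module n (length (T (Suc 0))) = J"
    using F(2) by (simp add: ind E0 resolves_def cong: image_cong)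
  moreover have "D 0 \<in> carrier_mat 1 (length (S (Suc 0)))" "E 0 \<in> carrier_mat 1 (length (T (Suc 0)))"
    using gmat_carrier[OF exact_gmat[OF D, of 0]] gmat_carrier[OF exact_gmat[OF E, of 0]] by (simp_all add: S0 ind)
  ultimately have im: "(\<lambda>v. D 0 *\<^sub>v v) ` free_module n (length (S (Suc 0))) = (\<lambda>v. E 0 *\<^sub>v v) ` free_module n (length (T (Suc 0)))"
    by (simp only: image_vec_1 imD)
  have minE: "min_mat (E (Suc i))" for i
    using F(3)[of _ i] gmat_carrier[OF exact_gmat[OF E, of "Suc i"]] by (auto simp: min_mat_def ind)
  have "S 0 = T 0" by (simp add: S0 ind)
  hence "count_list (T (Suc r)) d = count_list (S (Suc r)) d"
    using count_list_le_of_resolutions[OF D E minD _ im] count_list_le_of_resolutions[OF E D minE _ im[symmetric]]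
    by (metis le_antisym)
  thus ?thesis by (simp add: ind)
qed

text \<open>Existence for the definite description comes from cutting off \<open>S 0\<close> and
  using \<open>D 0\<close> as the augmentation; uniqueness is
  \<open>count_list_minimal_resolution\<close>.\<close>

lemma graded_betti_eq:
  assumes res: "res n J S D"
  shows "graded_betti n J r d = count_list (S (Suc r)) d"
proof -
  define F where "F = \<lparr>shifts = \<lambda>i. S (Suc i), aug = row (D 0) 0, diff = \<lambda>i. D (Suc i)\<rparr>"
  have ex: "exact n S D" and S0: "S 0 = [0]" and min: "\<And>i. min_mat (D i)"
    and im: "(\<lambda>v. (D 0 *\<^sub>v v) $ 0) ` free_module n (length (S (Suc 0))) = J"
    using res by (auto simp: res_def)
  note g = exact_gmat[OF ex]
  have D0: "dim_row (D 0) = Suc 0" "dim_col (D 0) = length (S (Suc 0))" using gmat_carrier[OF g[of 0]] by (auto simp: S0)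
  have D0v: "(D 0 *\<^sub>v v) $ 0 = row (D 0) 0 \<bullet> v" "row (D 0) 0 \<bullet> v = 0 \<longleftrightarrow> D 0 *\<^sub>v v = 0\<^sub>v (Suc 0)" for v
    by (auto simp: D0 vec_eq_iff)
  have row: "row (D 0) 0 \<in> carrier_vec (length (S (Suc 0)))"
    using row_carrier[of "D 0" 0] unfolding D0(2) .
  have ker0: "{v \<in> free_module n (length (S (Suc 0))). D 0 *\<^sub>v v = 0\<^sub>v (Suc 0)} =
      (\<lambda>v. D (Suc 0) *\<^sub>v v) ` free_module n (length (S (Suc (Suc 0))))"
    using ex[unfolded exact_def, THEN conjunct2, THEN spec[of _ 0]] by (simp add: S0)
  have "graded_free_complex n F"
    using g gmatD[OF g[of 0]] by (auto simp: graded_free_complex_def F_def gmat_def D0 S0 free_module_def row)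
  moreover have "resolves n J F"
    using im ex ker0 unfolding resolves_def D0v(1)
    by (simp add: F_def exact_def D0v(2))
  moreover have "const (D (Suc i) $$ (j, k)) = 0" if "j < length (S (Suc i))" "k < length (S (Suc (Suc i)))" for i j k
    using min[of "Suc i"] gmat_carrier[OF g[of "Suc i"]] that by (auto simp: min_mat_def)
  ultimately have "minimal_graded_free_resolution n J F"
    by (auto simp: minimal_graded_free_resolution_def F_def const_def)
  thus ?thesis unfolding graded_betti_def
    using count_list_minimal_resolution[OF res] by (intro the_equality) auto
qed

section \<open>The mapping cone of a chain map\<close>

lemma gmat_block:
  assumes "gmat n s t A" "gmat n s t' B" "gmat n s' t C" "gmat n s' t' D"
  shows "gmat n (s @ s') (t @ t') (four_block_mat A B C D)"
  using assms unfolding gmat_def by (auto simp: nth_append)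

lemma gmat_smult:
  assumes "gmat n s t M" "y \<in> R n" "homogeneous e y"
  shows "gmat n s (map (\<lambda>x. x + e) t) (y \<cdot>\<^sub>m M)"
proof -
  have "homogeneous (t ! k + e - s ! j) (y * M $$ (j, k))" if "j < length s" "k < length t" for j k
    using homogeneous_mult[OF assms(3) gmatD(2)[OF assms(1) that]] by (simp add: algebra_simps)
  thus ?thesis using assms by (auto simp: gmat_def)
qed

text \<open>Homogeneity of the entries depends only on differences of shifts, so a twist leaves the
  matrices unchanged.\<close>

lemma exact_shift: "exact n T E \<Longrightarrow> exact n (\<lambda>i. map (\<lambda>x. x + e) (T i)) E"
  by (simp add: exact_def gmat_def)

lemma mult_mat_uminus_vec:
  "dim_vec v = dim_col (A :: 'a::ring mat) \<Longrightarrow> A *\<^sub>v (- v) = - (A *\<^sub>v v)"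
  by (intro eq_vecI) (auto simp: scalar_prod_def sum_negf)

lemma free_module_append:
  "v \<in> free_module n a \<Longrightarrow> w \<in> free_module n b \<Longrightarrow> v @\<^sub>v w \<in> free_module n (a + b)"
  by (auto simp: free_module_def)

lemma free_module_appendE:
  assumes "v \<in> free_module n (a + b)"
  obtains u w where "v = u @\<^sub>v w" "u \<in> free_module n a" "w \<in> free_module n b"
proof (rule that[of "vec_first v a" "vec_last v b"])
  show "v = vec_first v a @\<^sub>v vec_last v b"
    using assms by (simp add: free_module_def)
qed (use assms in \<open>auto simp: free_module_def vec_first_def vec_last_def\<close>)

definition cone_shifts :: "(nat \<Rightarrow> int list) \<Rightarrow> (nat \<Rightarrow> int list) \<Rightarrow> nat \<Rightarrow> int list" where
  "cone_shifts S T i = S i @ (case i of 0 \<Rightarrow> [] | Suc j \<Rightarrow> T j)"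

text \<open>The map (a, b) to (D a + \<theta> b, - E b). In the cone \<open>T\<close> sits one
  position higher, so at index 0 the lower blocks have no rows.\<close>

definition cone_diff :: "(nat \<Rightarrow> int list) \<Rightarrow> (nat \<Rightarrow> int list) \<Rightarrow> (nat \<Rightarrow> 'k::field mpoly mat) \<Rightarrow> (nat \<Rightarrow> 'k mpoly mat) \<Rightarrow>
    (nat \<Rightarrow> 'k mpoly mat) \<Rightarrow> nat \<Rightarrow> 'k mpoly mat" where
  "cone_diff S T D E \<theta> i = (case i of
     0 \<Rightarrow> four_block_mat (D 0) (\<theta> 0) (0\<^sub>m 0 (length (S 1))) (0\<^sub>m 0 (length (T 0)))
   | Suc j \<Rightarrow> four_block_mat (D i) (\<theta> i) (0\<^sub>m (length (T j)) (length (S (Suc i)))) (- E j))"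

context
  fixes n :: nat and S T :: "nat \<Rightarrow> int list" and D E \<theta> :: "nat \<Rightarrow> 'k::field mpoly mat"
  assumes D: "exact n S D" and E: "exact n T E"
    and \<theta>: "\<And>i. gmat n (S i) (T i) (\<theta> i)" "\<And>i. \<theta> i * E i = D i * \<theta> (Suc i)"
begin

lemmas cone_carriers = gmat_carrier[OF exact_gmat[OF D]] gmat_carrier[OF exact_gmat[OF E]] gmat_carrier[OF \<theta>(1)]

lemma cone_gmat: "gmat n (cone_shifts S T i) (cone_shifts S T (Suc i)) (cone_diff S T D E \<theta> i)"
proof (cases i)
  case 0
  have "gmat n (S 0 @ []) (S 1 @ T 0) (cone_diff S T D E \<theta> 0)"
    unfolding cone_diff_def nat.case
    by (intro gmat_block) (use exact_gmat[OF D, of 0] \<theta>(1)[of 0] gmat_zero[of n "[]"] in auto)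
  thus ?thesis by (simp add: cone_shifts_def 0)
next
  case (Suc j)
  show ?thesis unfolding Suc cone_shifts_def cone_diff_def nat.case
    by (intro gmat_block exact_gmat[OF D] \<theta>(1) gmat_uminus exact_gmat[OF E] gmat_zero)
qed

lemma cone_diff_0_vec:
  assumes "a \<in> free_module n (length (S (Suc 0)))" "b \<in> free_module n (length (T 0))"
  shows "cone_diff S T D E \<theta> 0 *\<^sub>v (a @\<^sub>v b) = D 0 *\<^sub>v a + \<theta> 0 *\<^sub>v b"
proof -
  have "cone_diff S T D E \<theta> 0 *\<^sub>v (a @\<^sub>v b) = (D 0 *\<^sub>v a + \<theta> 0 *\<^sub>v b) @\<^sub>v
     (0\<^sub>m 0 (length (S 1)) *\<^sub>v a + 0\<^sub>m 0 (length (T 0)) *\<^sub>v b)"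
    unfolding cone_diff_def nat.case
    by (rule four_block_mat_mult_vec) (use cone_carriers[of 0] assms in \<open>auto dest: free_moduleD\<close>)
  also have "\<dots> = D 0 *\<^sub>v a + \<theta> 0 *\<^sub>v b" by (intro eq_vecI) auto
  finally show ?thesis .
qed

lemma cone_diff_Suc_vec:
  assumes "a \<in> free_module n (length (S (Suc (Suc i))))" "b \<in> free_module n (length (T (Suc i)))"
  shows "cone_diff S T D E \<theta> (Suc i) *\<^sub>v (a @\<^sub>v b) =
    (D (Suc i) *\<^sub>v a + \<theta> (Suc i) *\<^sub>v b) @\<^sub>v (- (E i *\<^sub>v b))"
proof -
  have [simp]: "dim_vec b = dim_col (E i)" "dim_row (E i) = length (T i)"
    using assms(2) cone_carriers(2)[of i] by (auto dest: free_moduleD)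
  have "cone_diff S T D E \<theta> (Suc i) *\<^sub>v (a @\<^sub>v b) = (D (Suc i) *\<^sub>v a + \<theta> (Suc i) *\<^sub>v b) @\<^sub>v
     (0\<^sub>m (length (T i)) (length (S (Suc (Suc i)))) *\<^sub>v a + (- E i) *\<^sub>v b)"
    unfolding cone_diff_def nat.case
    by (rule four_block_mat_mult_vec[OF cone_carriers(1) cone_carriers(3)]) (use cone_carriers(2)[of i] assms in \<open>auto dest: free_moduleD\<close>)
  also have "0\<^sub>m (length (T i)) (length (S (Suc (Suc i)))) *\<^sub>v a = 0\<^sub>v (length (T i))"
    using free_moduleD[OF assms(1)] by (intro eq_vecI) auto
  also have "0\<^sub>v (length (T i)) + (- E i) *\<^sub>v b = - (E i *\<^sub>v b)"
    by (intro eq_vecI) auto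
  finally show ?thesis .
qed

lemma chain_map_vec:
  assumes "w \<in> free_module n (length (T (Suc i)))"
  shows "\<theta> i *\<^sub>v (E i *\<^sub>v w) = D i *\<^sub>v (\<theta> (Suc i) *\<^sub>v w)"
  using assoc_mult_mat_vec[OF cone_carriers(3) cone_carriers(2) free_moduleD[OF assms]] assoc_mult_mat_vec[OF cone_carriers(1) cone_carriers(3) free_moduleD[OF assms]]
  by (simp add: \<theta>(2))

text \<open>Since \<theta> is a chain map, \<open>a\<close> plus the image of \<open>w\<close> under
  \<theta> is a cycle of \<open>D\<close>. If \<open>z\<close> bounds it, then (z, -w) is the
  preimage.\<close>

lemma cone_preimage:
  assumes a: "a \<in> free_module n (length (S (Suc i)))" and w: "w \<in> free_module n (length (T (Suc i)))"
    and 0: "D i *\<^sub>v a + \<theta> i *\<^sub>v (E i *\<^sub>v w) = 0\<^sub>v (length (S i))"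
  shows "a @\<^sub>v (E i *\<^sub>v w) \<in> (\<lambda>v. cone_diff S T D E \<theta> (Suc i) *\<^sub>v v) ` free_module n (length (cone_shifts S T (Suc (Suc i))))"
proof -
  let ?tw = "\<theta> (Suc i) *\<^sub>v w"
  have tw: "?tw \<in> free_module n (length (S (Suc i)))" by (rule gmat_mult_vec[OF \<theta>(1) w])
  have "D i *\<^sub>v (a + ?tw) = 0\<^sub>v (length (S i))"
    using 0 mult_add_distrib_mat_vec[OF cone_carriers(1) free_moduleD[OF a] free_moduleD[OF tw]] by (simp add: chain_map_vec[OF w])
  then obtain z where z: "z \<in> free_module n (length (S (Suc (Suc i))))" "a + ?tw = D (Suc i) *\<^sub>v z"
    using exact_ker[OF D free_module_closed(2)[OF a tw]] by blast
  note w' = free_module_closed(4)[OF w]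
  have dim: "dim_vec w = dim_col (\<theta> (Suc i))" "dim_vec w = dim_col (E i)"
    using carrier_vecD[OF free_moduleD[OF w]] carrier_matD[OF cone_carriers(2)[of i]] carrier_matD[OF cone_carriers(3)[of "Suc i"]]
    by simp_all
  have "cone_diff S T D E \<theta> (Suc i) *\<^sub>v (z @\<^sub>v (- w)) = (D (Suc i) *\<^sub>v z + \<theta> (Suc i) *\<^sub>v (- w)) @\<^sub>v (- (E i *\<^sub>v (- w)))"
    by (rule cone_diff_Suc_vec[OF z(1) w'])
  also have "\<theta> (Suc i) *\<^sub>v (- w) = - ?tw"
    by (rule mult_mat_uminus_vec[OF dim(1)])
  also have "E i *\<^sub>v (- w) = - (E i *\<^sub>v w)"
    by (rule mult_mat_uminus_vec[OF dim(2)])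
  also have "D (Suc i) *\<^sub>v z + - ?tw = a"
    unfolding z(2)[symmetric] using free_moduleD[OF a] free_moduleD[OF tw] by (intro eq_vecI) auto
  finally have "cone_diff S T D E \<theta> (Suc i) *\<^sub>v (z @\<^sub>v (- w)) = a @\<^sub>v (E i *\<^sub>v w)" by simp
  moreover have "z @\<^sub>v (- w) \<in> free_module n (length (cone_shifts S T (Suc (Suc i))))"
    using free_module_append[OF z(1) w'] by (simp add: cone_shifts_def)
  ultimately show ?thesis by (metis imageI)
qed

text \<open>The mixed contributions D \<theta> b and - \<theta> E b cancel; the sign in the lower
  right block is there for this.\<close>

lemma cone_comp:
  assumes "v \<in> free_module n (length (cone_shifts S T (Suc (Suc i))))"
  shows "cone_diff S T D E \<theta> i *\<^sub>v (cone_diff S T D E \<theta> (Suc i) *\<^sub>v v) = 0\<^sub>v (length (cone_shifts S T i))"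
proof -
  obtain a b where v: "v = a @\<^sub>v b" and a: "a \<in> free_module n (length (S (Suc (Suc i))))"
    and b: "b \<in> free_module n (length (T (Suc i)))"
    using free_module_appendE assms unfolding cone_shifts_def nat.case length_append by blast
  define a' where "a' = D (Suc i) *\<^sub>v a"
  define t where "t = \<theta> (Suc i) *\<^sub>v b"
  define b' where "b' = E i *\<^sub>v b"
  have a': "a' \<in> free_module n (length (S (Suc i)))" unfolding a'_def by (rule gmat_mult_vec[OF exact_gmat[OF D] a])
  have t: "t \<in> free_module n (length (S (Suc i)))" unfolding t_def by (rule gmat_mult_vec[OF \<theta>(1) b])
  have b': "b' \<in> free_module n (length (T i))" unfolding b'_def by (rule gmat_mult_vec[OF exact_gmat[OF E] b])
  have eq: "cone_diff S T D E \<theta> (Suc i) *\<^sub>v v = (a' + t) @\<^sub>v (- b')"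
    unfolding v a'_def b'_def t_def by (rule cone_diff_Suc_vec[OF a b])
  have "D i *\<^sub>v (a' + t) = D i *\<^sub>v a' + D i *\<^sub>v t"
    by (rule mult_add_distrib_mat_vec[OF cone_carriers(1) free_moduleD[OF a'] free_moduleD[OF t]])
  also have "D i *\<^sub>v a' = 0\<^sub>v (length (S i))" unfolding a'_def by (rule exact_comp_vec[OF D a])
  also have "D i *\<^sub>v t = \<theta> i *\<^sub>v b'" unfolding t_def b'_def by (rule chain_map_vec[OF b, symmetric])
  finally have "D i *\<^sub>v (a' + t) + \<theta> i *\<^sub>v (- b') = 0\<^sub>v (length (S i))"
    using gmat_mult_vec[OF \<theta>(1) b'] free_moduleD[OF b'] cone_carriers(3)[of i]
    by (auto simp: mult_mat_uminus_vec free_module_def intro!: eq_vecI)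
  moreover have "E j *\<^sub>v (- b') = 0\<^sub>v (length (T j))" if "i = Suc j" for j
    using exact_comp_vec[OF E b[unfolded that]] carrier_vecD[OF free_moduleD[OF b']] carrier_matD[OF cone_carriers(2)[of j]]
    by (simp add: mult_mat_uminus_vec b'_def that)
  moreover have "cone_diff S T D E \<theta> 0 *\<^sub>v ((a' + t) @\<^sub>v (- b')) = D 0 *\<^sub>v (a' + t) + \<theta> 0 *\<^sub>v (- b')" if "i = 0"
    using cone_diff_0_vec[OF free_module_closed(2) free_module_closed(4)] a' t b' unfolding that by blast
  moreover have "cone_diff S T D E \<theta> (Suc j) *\<^sub>v ((a' + t) @\<^sub>v (- b')) =
      (D (Suc j) *\<^sub>v (a' + t) + \<theta> (Suc j) *\<^sub>v (- b')) @\<^sub>v (- (E j *\<^sub>v (- b')))" if "i = Suc j" for j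
    using cone_diff_Suc_vec[OF free_module_closed(2) free_module_closed(4)] a' t b' unfolding that by blast
  moreover have "0\<^sub>v a @\<^sub>v (0\<^sub>v b :: 'k mpoly vec) = 0\<^sub>v (a + b)" for a b
    by (intro eq_vecI) auto
  ultimately show ?thesis unfolding eq
    by (cases i) (simp_all add: cone_shifts_def)
qed

text \<open>At a positive index the second component of a cycle is a cycle of \<open>E\<close>,
  hence a boundary, and \<open>cone_preimage\<close> applies. At index 0 this is supplied by
  \<open>key\<close>, which says that \<open>\<theta> 0\<close> maps the cokernel of
  \<open>E 0\<close> injectively into that of \<open>D 0\<close>.\<close>

lemma cone_exact:
  assumes key: "\<And>a b. a \<in> free_module n (length (S (Suc 0))) \<Longrightarrow> b \<in> free_module n (length (T 0)) \<Longrightarrow>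
      D 0 *\<^sub>v a + \<theta> 0 *\<^sub>v b = 0\<^sub>v (length (S 0)) \<Longrightarrow> b \<in> (\<lambda>v. E 0 *\<^sub>v v) ` free_module n (length (T (Suc 0)))"
  shows "exact n (cone_shifts S T) (cone_diff S T D E \<theta>)"
proof -
  have "v \<in> (\<lambda>v. cone_diff S T D E \<theta> (Suc i) *\<^sub>v v) ` free_module n (length (cone_shifts S T (Suc (Suc i))))"
    if v: "v \<in> free_module n (length (cone_shifts S T (Suc i)))"
      and 0: "cone_diff S T D E \<theta> i *\<^sub>v v = 0\<^sub>v (length (cone_shifts S T i))" for v i
  proof -
    obtain a b where ab: "v = a @\<^sub>v b" and a: "a \<in> free_module n (length (S (Suc i)))"
      and b: "b \<in> free_module n (length (T i))"
      using free_module_appendE v unfolding cone_shifts_def nat.case length_append by blast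
    have "D i *\<^sub>v a + \<theta> i *\<^sub>v b = 0\<^sub>v (length (S i)) \<and> b \<in> (\<lambda>v. E i *\<^sub>v v) ` free_module n (length (T (Suc i)))"
    proof (cases i)
      case 0
      thus ?thesis using that(2) a b key cone_diff_0_vec unfolding ab by (simp add: cone_shifts_def)
    next
      case (Suc j)
      have "(D i *\<^sub>v a + \<theta> i *\<^sub>v b) @\<^sub>v (- (E j *\<^sub>v b)) = 0\<^sub>v (length (S i)) @\<^sub>v 0\<^sub>v (length (T j))"
        using 0 a b unfolding ab Suc by (subst (asm) cone_diff_Suc_vec) (auto simp: cone_shifts_def)
      moreover have "D i *\<^sub>v a + \<theta> i *\<^sub>v b \<in> carrier_vec (length (S i))"
        by (rule add_carrier_vec[OF free_moduleD[OF gmat_mult_vec[OF exact_gmat[OF D] a]] free_moduleD[OF gmat_mult_vec[OF \<theta>(1) b]]])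
      ultimately have "D i *\<^sub>v a + \<theta> i *\<^sub>v b = 0\<^sub>v (length (S i))" "- (E j *\<^sub>v b) = 0\<^sub>v (length (T j))"
        using append_vec_eq[OF _ zero_carrier_vec] by blast+
      moreover from this(2) have "E j *\<^sub>v b = 0\<^sub>v (length (T j))"
        by (metis uminus_uminus_vec uminus_zero_vec)
      ultimately show ?thesis using exact_ker[OF E] b unfolding Suc by blast
    qed
    thus ?thesis using cone_preimage[OF a] unfolding ab by auto
  qed
  moreover have "cone_diff S T D E \<theta> (Suc i) *\<^sub>v v \<in> free_module n (length (cone_shifts S T (Suc i)))"
    if "v \<in> free_module n (length (cone_shifts S T (Suc (Suc i))))" for v i
    by (rule gmat_mult_vec[OF cone_gmat that])
  ultimately show ?thesis
    unfolding exact_def using cone_gmat cone_comp by (blast intro!: set_eqI)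
qed

end

lemma min_mat_block:
  "min_mat A \<Longrightarrow> min_mat B \<Longrightarrow> min_mat C \<Longrightarrow> min_mat D \<Longrightarrow>
    dim_row A = dim_row B \<Longrightarrow> dim_col A = dim_col C \<Longrightarrow> dim_row C = dim_row D \<Longrightarrow> dim_col B = dim_col D \<Longrightarrow>
    min_mat (four_block_mat A B C D)"
  by (auto simp: min_mat_def)

lemma const_uminus [simp]: "const (- p) = - const p"
  by (simp add: const_def)

lemma res_image:
  assumes "res n J S D"
  shows "(\<lambda>v. D 0 *\<^sub>v v) ` free_module n (length (S (Suc 0))) = (\<lambda>p. vec 1 (\<lambda>_. p)) ` J"
proof -
  have "D 0 \<in> carrier_mat 1 (length (S (Suc 0)))"
    using assms gmat_carrier[OF exact_gmat[of n S D 0]] by (simp add: res_def)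
  thus ?thesis using image_vec_1[of "D 0"] assms by (simp add: res_def)
qed

text \<open>Multiplication by \<open>f\<close> already carries \<open>C\<close> into
  \<open>J\<close>, so it lifts to a chain map. Multiplying that lift by \<open>y\<close> gives a
  lift of multiplication by \<open>y * f\<close> without constant terms, which keeps the cone
  minimal. The condition \<open>colon\<close> yields the injectivity required by
  \<open>cone_exact\<close>.\<close>

lemma res_cone:
  assumes J: "res n J S D" and C: "res n C T E"
    and f: "f \<in> R n" "homogeneous e f" "\<And>p. p \<in> C \<Longrightarrow> f * p \<in> J"
    and y: "y \<in> R n" "homogeneous 1 y" "const y = 0"
    and colon: "\<And>p. p \<in> R n \<Longrightarrow> p * (y * f) \<in> J \<Longrightarrow> p \<in> C"
  obtains U H where "res n {a + p * (y * f) | a p. a \<in> J \<and> p \<in> R n} U H"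
    "U 0 = [0]" "\<And>i. U (Suc i) = S (Suc i) @ map (\<lambda>x. x + (e + 1)) (T i)"
proof -
  have D: "exact n S D" and S0: "S 0 = [0]" and minD: "\<And>i. min_mat (D i)"
    using J by (auto simp: res_def)
  have E: "exact n T E" and T0: "T 0 = [0]" and minE: "\<And>i. min_mat (E i)"
    using C by (auto simp: res_def)
  \<comment> \<open>The twists by the degrees of \<open>f\<close> and of \<open>y * f\<close> make
    the two multiplications degree-preserving.\<close>
  define T1 where "T1 i = map (\<lambda>x. x + e) (T i)" for i
  define T2 where "T2 i = map (\<lambda>x. x + (e + 1)) (T i)" for i
  have E1: "exact n T1 E" and E2: "exact n T2 E"
    unfolding T1_def T2_def by (rule exact_shift[OF E])+
  define \<phi>0 where "\<phi>0 = mat 1 1 (\<lambda>_. f)"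
  have g0: "gmat n (S 0) (T1 0) \<phi>0"
    using f by (simp add: gmat_def \<phi>0_def S0 T0 T1_def)
  have gE0: "E 0 \<in> carrier_mat 1 (length (T (Suc 0)))"
    using gmat_carrier[OF exact_gmat[OF E, of 0]] by (simp add: T0)
  have im: "col (\<phi>0 * E 0) k \<in> (\<lambda>v. D 0 *\<^sub>v v) ` free_module n (length (S (Suc 0)))"
    if "k < length (T1 (Suc 0))" for k
  proof -
    have k: "k < length (T (Suc 0))" using that by (simp add: T1_def)
    have "vec 1 (\<lambda>_. E 0 $$ (0, k)) = E 0 *\<^sub>v unit_vec (length (T (Suc 0))) k"
      unfolding mult_unit_vec_col[OF gE0 k] using gE0 k by (intro eq_vecI) auto
    also have "\<dots> \<in> (\<lambda>p. vec 1 (\<lambda>_. p)) ` C"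
      using unit_vec_free[OF k] unfolding res_image[OF C, symmetric] by (rule imageI)
    finally have "E 0 $$ (0, k) \<in> C" by (auto simp: vec_eq_iff)
    hence "vec 1 (\<lambda>_. f * E 0 $$ (0, k)) \<in> (\<lambda>p. vec 1 (\<lambda>_. p)) ` J" using f(3) by blast
    moreover have "vec 1 (\<lambda>_. f * E 0 $$ (0, k)) = col (\<phi>0 * E 0) k"
      using gE0 k by (intro eq_vecI) (auto simp: \<phi>0_def scalar_prod_def)
    ultimately show ?thesis unfolding res_image[OF J] by simp
  qed
  obtain \<phi> where \<phi>: "\<phi> 0 = \<phi>0" "\<And>i. gmat n (S i) (T1 i) (\<phi> i)" "\<And>i. \<phi> i * E i = D i * \<phi> (Suc i)"
    using chain_map_lift[OF E1 D g0 im] by blast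
  define \<theta> where "\<theta> i = y \<cdot>\<^sub>m \<phi> i" for i
  have gt: "gmat n (S i) (T2 i) (\<theta> i)" for i
    using gmat_smult[OF \<phi>(2)[of i] y(1,2)] by (simp add: \<theta>_def T1_def T2_def o_def add.assoc)
  have ct: "\<theta> i * E i = D i * \<theta> (Suc i)" for i
    unfolding \<theta>_def
    using mult_smult_assoc_mat[OF gmat_carrier[OF \<phi>(2)[of i]] gmat_carrier[OF exact_gmat[OF E1]], of y]
      mult_smult_distrib[OF gmat_carrier[OF exact_gmat[OF D]] gmat_carrier[OF \<phi>(2)[of "Suc i"]], of y]
    by (simp add: \<phi>(3))
  have min\<theta>: "min_mat (\<theta> i)" for i
    using y(3) by (simp add: min_mat_def \<theta>_def const_mult)
  have \<theta>0: "(\<theta> 0 *\<^sub>v b) $ 0 = b $ 0 * (y * f)" if "b \<in> free_module n 1" for b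
    using carrier_vecD[OF free_moduleD[OF that]] by (simp add: \<theta>_def \<phi>(1) \<phi>0_def scalar_prod_def)
  have D0: "dim_row (D 0) = Suc 0" "dim_col (D 0) = length (S (Suc 0))" using gmat_carrier[OF exact_gmat[OF D, of 0]] by (auto simp: S0)
  have \<theta>0': "dim_row (\<theta> 0) = Suc 0" by (simp add: \<theta>_def \<phi>(1) \<phi>0_def)
  have J0: "(D 0 *\<^sub>v a) $ 0 \<in> J" if "a \<in> free_module n (length (S (Suc 0)))" for a
    using J that unfolding res_def by blast
  let ?U = "cone_shifts S T2" and ?H = "cone_diff S T2 D E \<theta>"
  have ex: "exact n ?U ?H"
  proof (rule cone_exact[OF D E2 gt ct])
    fix a b assume a: "a \<in> free_module n (length (S (Suc 0)))" and b: "b \<in> free_module n (length (T2 0))"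
      and 0: "D 0 *\<^sub>v a + \<theta> 0 *\<^sub>v b = 0\<^sub>v (length (S 0))"
    have b1: "b \<in> free_module n 1" using b by (simp add: T2_def T0)
    have "(D 0 *\<^sub>v a + \<theta> 0 *\<^sub>v b) $ 0 = 0" unfolding 0 S0 by simp
    hence "(D 0 *\<^sub>v a) $ 0 + b $ 0 * (y * f) = 0"
      by (simp add: \<theta>0[OF b1] \<theta>0' del: index_mult_mat_vec)
    hence "b $ 0 * (y * f) = - (D 0 *\<^sub>v a) $ 0"
      by (metis add.commute eq_neg_iff_add_eq_0)
    also have "\<dots> = (D 0 *\<^sub>v (- a)) $ 0"
      using carrier_vecD[OF free_moduleD[OF a]] by (subst mult_mat_uminus_vec) (simp_all add: D0)
    finally have "b $ 0 * (y * f) \<in> J" using J0[OF free_module_closed(4)[OF a]] by simp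
    hence "b $ 0 \<in> C" using b1 by (intro colon) (auto simp: free_module_def)
    moreover have "b = vec 1 (\<lambda>_. b $ 0)" using carrier_vecD[OF free_moduleD[OF b1]] by (intro eq_vecI) auto
    ultimately have "b \<in> (\<lambda>p. vec 1 (\<lambda>_. p)) ` C" by blast
    thus "b \<in> (\<lambda>v. E 0 *\<^sub>v v) ` free_module n (length (T2 (Suc 0)))"
      unfolding res_image[OF C, symmetric] by (simp add: T2_def)
  qed
  have len: "length (T2 i) = length (T i)" for i by (simp add: T2_def)
  have min: "min_mat (?H i)" for i
  proof -
    note cD = carrier_matD[OF gmat_carrier[OF exact_gmat[OF D, of i]]]
      and ct = carrier_matD[OF gmat_carrier[OF gt, of i]]
      and cE = carrier_matD[OF gmat_carrier[OF exact_gmat[OF E2]]]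
    have zero: "min_mat (0\<^sub>m a b)" for a b by (simp add: min_mat_def)
    have uminus: "min_mat (- M)" if "min_mat M" for M using that by (simp add: min_mat_def)
    show ?thesis
      using cD ct cE unfolding cone_diff_def
      by (cases i) (auto intro!: min_mat_block minD min\<theta> zero uminus minE)
  qed
  have U0: "?U 0 = [0]" by (simp add: cone_shifts_def S0)
  have "(\<lambda>v. (?H 0 *\<^sub>v v) $ 0) ` free_module n (length (?U (Suc 0))) = {a + p * (y * f) | a p. a \<in> J \<and> p \<in> R n}"
  proof -
    have H0: "(?H 0 *\<^sub>v (a @\<^sub>v b)) $ 0 = (D 0 *\<^sub>v a) $ 0 + b $ 0 * (y * f)"
      if "a \<in> free_module n (length (S (Suc 0)))" "b \<in> free_module n 1" for a b
    proof -
      have "b \<in> free_module n (length (T2 0))" using that by (simp add: T2_def T0)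
      from cone_diff_0_vec[OF D E2 gt ct that(1) this] show ?thesis
        using \<theta>0[OF that(2)] by (simp add: \<theta>0' del: index_mult_mat_vec)
    qed
    have len1: "length (?U (Suc 0)) = length (S (Suc 0)) + 1"
      by (simp add: cone_shifts_def T2_def T0)
    show ?thesis
    proof (intro equalityI subsetI)
      fix q assume "q \<in> (\<lambda>v. (?H 0 *\<^sub>v v) $ 0) ` free_module n (length (?U (Suc 0)))"
      then obtain a b where "q = (?H 0 *\<^sub>v (a @\<^sub>v b)) $ 0"
        and a: "a \<in> free_module n (length (S (Suc 0)))" and b: "b \<in> free_module n 1"
        unfolding len1 by (blast elim: free_module_appendE)
      moreover have "b $ 0 \<in> R n" using b by (simp add: free_module_def)
      ultimately show "q \<in> {a + p * (y * f) | a p. a \<in> J \<and> p \<in> R n}"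
        using H0[OF a b] J0[OF a] by auto
    next
      fix q assume "q \<in> {a + p * (y * f) | a p. a \<in> J \<and> p \<in> R n}"
      then obtain j p where q: "q = j + p * (y * f)" "j \<in> J" and p: "p \<in> R n" by blast
      obtain a where a: "a \<in> free_module n (length (S (Suc 0)))" "j = (D 0 *\<^sub>v a) $ 0"
        using J q(2) by (auto simp: res_def)
      have b: "vec 1 (\<lambda>_. p) \<in> free_module n 1" using p by (simp add: free_module_def)
      have "q = (?H 0 *\<^sub>v (a @\<^sub>v vec 1 (\<lambda>_. p))) $ 0"
        using H0[OF a(1) b] by (simp add: q(1) a(2))
      thus "q \<in> (\<lambda>v. (?H 0 *\<^sub>v v) $ 0) ` free_module n (length (?U (Suc 0)))"
        using free_module_append[OF a(1) b] unfolding len1 by blast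
    qed
  qed
  hence "res n {a + p * (y * f) | a p. a \<in> J \<and> p \<in> R n} ?U ?H"
    using ex min U0 by (simp add: res_def)
  thus ?thesis
    by (rule that) (simp_all add: U0, simp add: cone_shifts_def T2_def)
qed

lemma res_zero: "\<exists>D. res n ({0} :: 'k::field mpoly set) (\<lambda>i. if i = 0 then [0] else []) D"
proof -
  define S :: "nat \<Rightarrow> int list" where "S = (\<lambda>i. if i = 0 then [0] else [])"
  define D :: "nat \<Rightarrow> 'k mpoly mat" where "D = (\<lambda>i. 0\<^sub>m (length (S i)) (length (S (Suc i))))"
  have free: "free_module n 0 = {0\<^sub>v 0 :: 'k mpoly vec}"
    by (auto simp: free_module_def)
  have zero: "D i *\<^sub>v 0\<^sub>v 0 = 0\<^sub>v (length (S i))" for i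
    by (intro eq_vecI) (auto simp: D_def scalar_prod_def S_def)
  have S: "length (S (Suc i)) = 0" for i by (simp add: S_def)
  have "{v \<in> free_module n 0. D i *\<^sub>v v = 0\<^sub>v (length (S i))} = (\<lambda>v. D (Suc i) *\<^sub>v v) ` free_module n 0" for i
    unfolding free image_insert image_empty zero S using zero by blast
  hence "exact n S D"
    by (simp add: exact_def D_def gmat_zero) (simp add: S_def)
  moreover have "(\<lambda>v. (D 0 *\<^sub>v v) $ 0) ` free_module n (length (S (Suc 0))) = {0}"
    by (simp add: S_def free D_def scalar_prod_def)
  ultimately have "res n {0} S D"
    by (simp add: res_def S_def) (simp add: D_def min_mat_def)
  thus ?thesis unfolding S_def by blast
qed

section \<open>Squarefree monomial ideals\<close>

definition sqfree :: "nat set \<Rightarrow> (nat \<Rightarrow>\<^sub>0 nat)" where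
  "sqfree A = (\<Sum>i\<in>A. Poly_Mapping.single i 1)"

definition xmon :: "nat set \<Rightarrow> 'k::field mpoly" where
  "xmon A = Poly_Mapping.single (sqfree A) 1"

lemma lookup_sqfree: "finite A \<Longrightarrow> Poly_Mapping.lookup (sqfree A) i = (if i \<in> A then 1 else 0)"
  by (simp add: sqfree_def lookup_sum lookup_single when_def)

lemma keys_sqfree: "finite A \<Longrightarrow> Poly_Mapping.keys (sqfree A) = A"
  by (auto simp: in_keys_iff lookup_sqfree split: if_splits)

lemma mdeg_sqfree: "finite A \<Longrightarrow> mdeg (sqfree A) = int (card A)"
  by (simp add: mdeg_def keys_sqfree lookup_sqfree)

lemma xmon_eq_prod: "finite A \<Longrightarrow> xmon A = (\<Prod>i\<in>A. var i :: 'k::field mpoly)"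
proof (induction A rule: finite_induct)
  case (insert x A)
  have "xmon (insert x A) = (var x * xmon A :: 'k mpoly)"
    using insert.hyps by (simp add: xmon_def sqfree_def var_def mult_single)
  thus ?case using insert by simp
qed (simp add: xmon_def sqfree_def)

lemma supported_xmon: "supported P (xmon A :: 'k::field mpoly) \<longleftrightarrow> P (sqfree A)"
  by (simp add: supported_def xmon_def)

lemma xmon_nonzero [simp]: "xmon A \<noteq> 0"
  using supported_xmon[of "\<lambda>_. False" A] supported_zero by metis

text \<open>Membership of a monomial in a squarefree monomial ideal depends only on its set of
  variables, so such an ideal is encoded as a predicate on sets. For upward closed \<open>P\<close>
  this is indeed an ideal, see \<open>mono_ideal_ideal\<close>.\<close>

definition mono_ideal :: "nat \<Rightarrow> (nat set \<Rightarrow> bool) \<Rightarrow> 'k::field mpoly set" where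
  "mono_ideal n P = {p \<in> R n. supported (\<lambda>m. P (Poly_Mapping.keys m)) p}"

lemma mono_ideal_cong:
  assumes "\<And>A. A \<subseteq> {1..n} \<Longrightarrow> P A \<longleftrightarrow> Q A"
  shows "mono_ideal n P = mono_ideal n Q"
  using assms unfolding mono_ideal_def carrier_supported supported_def by blast

text \<open>Since \<open>P\<close> only sees supports, the colon ideal by the monomial of \<open>A\<close> is again of the form \<open>mono_ideal\<close>.\<close>

lemma mult_xmon_in_mono_ideal_iff:
  assumes A: "finite A" "A \<subseteq> {1..n}" and p: "(p :: 'k::field mpoly) \<in> R n"
  shows "p * xmon A \<in> mono_ideal n P \<longleftrightarrow> p \<in> mono_ideal n (\<lambda>B. P (B \<union> A))"
proof -
  let ?Q = "\<lambda>m. P (Poly_Mapping.keys m \<union> A)"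
  have x: "supported (\<lambda>m. m = sqfree A) (xmon A :: 'k mpoly)" by (simp add: supported_xmon)
  have mult: "supported (\<lambda>m. P' (Poly_Mapping.keys m)) (q * xmon A)"
    if "supported (\<lambda>m. P' (Poly_Mapping.keys m \<union> A)) q" for P' and q :: "'k mpoly"
    by (rule supported_mult[OF that x]) (simp add: keys_add_nat keys_sqfree A)
  have "xmon A \<in> (R n :: 'k mpoly set)"
    using A by (simp add: carrier_supported supported_xmon keys_sqfree)
  hence R: "p * xmon A \<in> R n" using p by blast
  \<comment> \<open>The part \<open>b\<close> violating \<open>?Q\<close> has a product with
    \<open>xmon A\<close> that is supported both inside and outside \<open>P\<close>. The product is
    therefore 0, and so is \<open>b\<close>, since there are no zero divisors.\<close>
  have "supported ?Q p" if px: "supported (\<lambda>m. P (Poly_Mapping.keys m)) (p * xmon A)"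
  proof -
    obtain a b where ab: "p = a + b" "supported ?Q a" "supported (\<lambda>m. \<not> ?Q m) b"
      by (rule supported_split)
    have "supported (\<lambda>m. P (Poly_Mapping.keys m)) (b * xmon A)"
      using supported_diff[OF px mult[OF ab(2)]] by (simp add: ab(1) algebra_simps)
    moreover have "supported (\<lambda>m. \<not> P (Poly_Mapping.keys m)) (b * xmon A)"
      by (rule mult[OF ab(3)])
    ultimately have "Poly_Mapping.keys (b * xmon A) = {}"
      unfolding supported_def by blast
    hence "b = 0" by simp
    thus ?thesis using ab by simp
  qed
  thus ?thesis using mult[of P p] R p by (auto simp: mono_ideal_def)
qed

lemma single_div_xmon:
  assumes "finite A" "A \<subseteq> Poly_Mapping.keys m"
  shows "Poly_Mapping.single m c = Poly_Mapping.single (m - sqfree A) c * (xmon A :: 'k::field mpoly)"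
proof -
  have "m - sqfree A + sqfree A = m"
    using assms by (intro poly_mapping_eqI) (auto simp: lookup_add lookup_minus lookup_sqfree in_keys_iff subset_iff)
  thus ?thesis by (simp add: xmon_def mult_single)
qed

lemma poly_mapping_sum_single: "p = (\<Sum>m\<in>Poly_Mapping.keys p. Poly_Mapping.single m (Poly_Mapping.lookup p m))"
  by (intro poly_mapping_eqI) (simp add: lookup_sum lookup_single when_def in_keys_iff)

lemma single_diff_in_R:
  "Poly_Mapping.keys m \<subseteq> {1..n} \<Longrightarrow> Poly_Mapping.single (m - a) c \<in> R n"
  by (auto simp: carrier_supported supported_def in_keys_iff lookup_minus subset_iff split: if_splits)

text \<open>Adjoining a generator: the monomials whose support fails \<open>P\<close> are divisible
  by \<open>xmon A\<close>, and their quotients add up to \<open>p\<close>.\<close>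

lemma mono_ideal_insert:
  assumes A: "finite A" "A \<subseteq> {1..n}"
  shows "{a + p * xmon A | a p. a \<in> mono_ideal n P \<and> p \<in> R n} =
    (mono_ideal n (\<lambda>B. P B \<or> A \<subseteq> B) :: 'k::field mpoly set)" (is "?L = ?R")
proof (intro equalityI subsetI)
  fix q assume "q \<in> ?L"
  then obtain a p where q: "q = a + p * xmon A" "a \<in> mono_ideal n P" "p \<in> R n" by blast
  have "p * xmon A \<in> ?R"
    using q(3) by (simp add: mult_xmon_in_mono_ideal_iff[OF A]) (simp add: mono_ideal_def supported_def)
  moreover have "a \<in> ?R" using q(2) by (auto simp: mono_ideal_def supported_def)
  ultimately show "q \<in> ?R" unfolding q(1) mono_ideal_def by (auto intro: supported_add)
next
  fix q assume q: "q \<in> ?R"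
  obtain a b where ab: "q = a + b" "supported (\<lambda>m. P (Poly_Mapping.keys m)) a"
      "supported (\<lambda>m. \<not> P (Poly_Mapping.keys m)) b"
      "Poly_Mapping.keys a \<subseteq> Poly_Mapping.keys q" "Poly_Mapping.keys b \<subseteq> Poly_Mapping.keys q"
    by (rule supported_split)
  have "a \<in> mono_ideal n P"
    using q ab(2,4) unfolding mono_ideal_def carrier_supported supported_def by blast
  moreover have b: "A \<subseteq> Poly_Mapping.keys m" "Poly_Mapping.keys m \<subseteq> {1..n}" if "m \<in> Poly_Mapping.keys b" for m
    using q ab(3,5) that unfolding mono_ideal_def carrier_supported supported_def by blast+
  let ?p = "\<Sum>m\<in>Poly_Mapping.keys b. Poly_Mapping.single (m - sqfree A) (Poly_Mapping.lookup b m)"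
  have "b = ?p * xmon A"
    unfolding sum_distrib_right
    by (subst poly_mapping_sum_single) (intro sum.cong refl single_div_xmon A(1) b(1))
  moreover have "?p \<in> R n" by (intro R_sum single_diff_in_R b(2))
  ultimately have "q = a + ?p * xmon A \<and> a \<in> mono_ideal n P \<and> ?p \<in> R n"
    using ab(1) by presburger
  thus "q \<in> ?L" unfolding mem_Collect_eq by (intro exI)
qed

section \<open>Betti tables when a generator is added\<close>

lemma mono_ideal_False: "mono_ideal n (\<lambda>_. False) = {0}"
  by (auto simp: mono_ideal_def supported_def)

text \<open>
  \<open>\<beta>\<close> lists the Betti numbers of the quotient ring; homological degrees are integers to allow the
  shift \<open>i - 1\<close> in the mapping cone.
\<close>

definition has_betti :: "'k::field itself \<Rightarrow> nat \<Rightarrow> (nat set \<Rightarrow> bool) \<Rightarrow> (int \<Rightarrow> int \<Rightarrow> rat) \<Rightarrow> bool" where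
  "has_betti _ n P \<beta> \<longleftrightarrow>
     (\<exists>S D. res n (mono_ideal n P :: 'k mpoly set) S D \<and> (\<forall>i d. of_nat (count_list (S i) d) = \<beta> (int i) d)) \<and>
     (\<forall>i d. i < 0 \<longrightarrow> \<beta> i d = 0)"

lemma has_betti_False:
  "has_betti TYPE('k::field) n (\<lambda>_. False) (\<lambda>i d. if i = 0 \<and> d = 0 then 1 else 0)"
  using res_zero[of n] unfolding has_betti_def mono_ideal_False
  by (auto intro!: exI[of _ "\<lambda>i. if i = 0 then [0] else []"])

lemma has_betti_cong:
  assumes "has_betti TYPE('k::field) n P \<beta>" "\<And>A. A \<subseteq> {1..n} \<Longrightarrow> P A \<longleftrightarrow> Q A" "\<And>i d. \<beta> i d = \<gamma> i d"
  shows "has_betti TYPE('k) n Q \<gamma>"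
proof -
  have "\<beta> = \<gamma>" using assms(3) by blast
  moreover have "mono_ideal n P = (mono_ideal n Q :: 'k mpoly set)"
    by (rule mono_ideal_cong[OF assms(2)])
  ultimately show ?thesis using assms(1) by (simp add: has_betti_def)
qed

lemma count_list_map_add: "count_list (map (\<lambda>x. x + c) xs) d = count_list xs (d - c :: int)"
  by (induction xs) auto

text \<open>Numerical form of \<open>res_cone\<close> with \<open>f = xmon B\<close>. The condition
  \<open>colon\<close> makes \<open>C\<close> the colon ideal by the whole monomial, while
  \<open>C'\<close> says that the factor without \<open>y\<close> already suffices to carry
  \<open>C\<close> into the ideal of \<open>P\<close>.\<close>

lemma has_betti_insert:
  assumes P: "has_betti TYPE('k::field) n P \<beta>" and C: "has_betti TYPE('k) n C \<gamma>"
    and colon: "\<And>A. A \<subseteq> {1..n} \<Longrightarrow> C A \<longleftrightarrow> P (A \<union> insert y B)"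
    and C': "\<And>A. A \<subseteq> {1..n} \<Longrightarrow> C A \<Longrightarrow> P (A \<union> B)"
    and y: "y \<notin> B" "insert y B \<subseteq> {1..n}"
  shows "has_betti TYPE('k) n (\<lambda>A. P A \<or> insert y B \<subseteq> A) (\<lambda>i d. \<beta> i d + \<gamma> (i - 1) (d - (int (card B) + 1)))"
proof -
  have fin: "finite B" using y(2) finite_subset by fastforce
  obtain S D where S: "res n (mono_ideal n P :: 'k mpoly set) S D" "\<And>i d. of_nat (count_list (S i) d) = \<beta> (int i) d"
    using P by (auto simp: has_betti_def)
  obtain T E where T: "res n (mono_ideal n C :: 'k mpoly set) T E" "\<And>i d. of_nat (count_list (T i) d) = \<gamma> (int i) d"
    using C by (auto simp: has_betti_def)
  have neg: "\<beta> i d = 0" "\<gamma> i d = 0" if "i < 0" for i d using P C that by (auto simp: has_betti_def)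
  let ?f = "xmon B :: 'k mpoly" and ?y = "xmon {y} :: 'k mpoly"
  have prod: "?y * ?f = xmon (insert y B)" using fin y(1) by (simp add: xmon_eq_prod)
  have carr: "q \<in> R n" if "q \<in> mono_ideal n Q" for q Q using that by (simp add: mono_ideal_def)
  obtain U H where U: "res n {a + p * (?y * ?f) | a p. a \<in> mono_ideal n P \<and> p \<in> R n} U H"
    "U 0 = [0]" "\<And>i. U (Suc i) = S (Suc i) @ map (\<lambda>x. x + (int (card B) + 1)) (T i)"
  proof (rule res_cone[OF S(1) T(1), of ?f "int (card B)" ?y])
    show "?f \<in> R n" "?y \<in> R n" "homogeneous (int (card B)) ?f" "homogeneous 1 ?y"
      using y fin by (auto simp: carrier_supported homogeneous_supported supported_xmon keys_sqfree mdeg_sqfree)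
    have "sqfree {y} \<noteq> 0" using keys_sqfree[of "{y}"] by auto
    thus "const ?y = 0" by (simp add: const_supported[symmetric] supported_xmon)
    show "?f * p \<in> mono_ideal n P" if "p \<in> mono_ideal n C" for p
    proof -
      have "p \<in> mono_ideal n (\<lambda>A. P (A \<union> B))"
        using that C' unfolding mono_ideal_def carrier_supported supported_def by blast
      thus ?thesis using mult_xmon_in_mono_ideal_iff[OF fin _ carr[OF that], of P] y(2)
        by (simp add: mult.commute)
    qed
    have "mono_ideal n C = (mono_ideal n (\<lambda>A. P (A \<union> insert y B)) :: 'k mpoly set)"
      by (rule mono_ideal_cong[OF colon])
    thus "p \<in> mono_ideal n C" if "p \<in> R n" "p * (?y * ?f) \<in> mono_ideal n P" for p
      using that mult_xmon_in_mono_ideal_iff[of "insert y B" n p P] fin y(2) unfolding prod by simp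
  qed blast
  have "res n (mono_ideal n (\<lambda>A. P A \<or> insert y B \<subseteq> A) :: 'k mpoly set) U H"
    using U(1) fin y(2) unfolding prod by (subst (asm) mono_ideal_insert) auto
  moreover have "of_nat (count_list (U i) d) = \<beta> (int i) d + \<gamma> (int i - 1) (d - (int (card B) + 1))" for i d
  proof (cases i)
    case 0
    have "S 0 = [0]" using S(1) by (simp add: res_def)
    thus ?thesis using S(2)[of 0 d] by (simp add: 0 U(2) neg)
  next
    case (Suc j)
    show ?thesis using S(2)[of i d] T(2)[of j "d - (int (card B) + 1)"]
      by (simp add: Suc U(3) count_list_map_add)
  qed
  ultimately show ?thesis by (auto simp: has_betti_def neg)
qed

section \<open>Solving the recursion\<close>

text \<open>With zero for all arguments outside the triangle, the rule fails only at the apex, where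
  1 would have to equal 0 + 0.\<close>

lemma binom_pascal:
  assumes "a \<noteq> 0 \<or> b \<noteq> 0"
  shows "binom a b = binom (a - 1) b + binom (a - 1) (b - 1)"
proof (cases "0 < b \<and> b \<le> a")
  case True
  then obtain a' b' where ab: "a = int (Suc a')" "b = int (Suc b')"
    by (metis gr0_implies_Suc order_less_le_trans pos_int_cases)
  with True have "b' \<le> a'" by simp
  thus ?thesis by (cases "b' = a'") (simp_all add: binom_def ab nat_add_distrib)
qed (use assms in \<open>auto simp: binom_def\<close>)

text \<open>Trinomial revision holds for all integers because each side vanishes unless 0 \<le> e
  \<le> j \<le> a.\<close>

lemma binom_trinomial: "binom a j * binom j e = binom (a - e) (j - e) * binom a e"
proof (cases "0 \<le> e \<and> e \<le> j \<and> j \<le> a")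
  case True
  then obtain a' j' e' where *: "a = int a'" "j = int j'" "e = int e'"
    by (metis nonneg_int_cases order_trans)
  with True have "e' \<le> j'" "j' \<le> a'" by simp_all
  thus ?thesis using choose_mult[of e' j' a', THEN arg_cong[of _ _ "of_nat :: nat \<Rightarrow> rat"]]
    by (simp add: binom_def * of_nat_diff[symmetric] del: of_nat_diff)
qed (auto simp: binom_def)

text \<open>The coefficient of \<open>z\<^sup>m t\<^sup>i s\<^sup>d\<close> in \<open>1 / (1 - z - t s\<^sup>3 (1 + t s) z\<^sup>4)\<close>.\<close>

definition gf_coeff :: "int \<Rightarrow> int \<Rightarrow> int \<Rightarrow> rat" where
  "gf_coeff m i d =
     (let j = (d - i) div 2 in if even (d - i) then binom (m - 3 * j) j * binom j (i - j) else 0)"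

text \<open>The recursion read off from the denominator; the excluded index carries the constant
  numerator 1. The proof applies the Pascal rule once to each binomial factor.\<close>

lemma gf_coeff_rec:
  assumes "m \<noteq> 0"
  shows "gf_coeff m i d = gf_coeff (m - 1) i d + gf_coeff (m - 4) (i - 1) (d - 3) + gf_coeff (m - 4) (i - 2) (d - 4)"
proof (cases "even (d - i)")
  case True
  then obtain j where d: "d = i + 2 * j" by (metis add_diff_cancel_left' diff_add_cancel dvdE add.commute)
  have j: "(d - i) div 2 = j" "(d - 3 - (i - 1)) div 2 = j - 1" "(d - 4 - (i - 2)) div 2 = j - 1"
      "even (d - 3 - (i - 1))" "even (d - 4 - (i - 2))"
    by (simp_all add: d)
  have "binom (m - 3 * j) j = binom (m - 3 * j - 1) j + binom (m - 3 * j - 1) (j - 1)"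
    using assms by (intro binom_pascal) auto
  moreover have "binom (m - 3 * j - 1) (j - 1) * binom j (i - j) =
      binom (m - 3 * j - 1) (j - 1) * (binom (j - 1) (i - j) + binom (j - 1) (i - j - 1))"
    by (cases "j = 0") (simp_all add: binom_def[of _ "-1"] binom_pascal[of j])
  ultimately show ?thesis
    using True unfolding gf_coeff_def j Let_def by (simp add: algebra_simps j)
qed (auto simp: gf_coeff_def)

text \<open>The coefficient of \<open>z\<^sup>m t\<^sup>i s\<^sup>d\<close> after the numerator 1 is
  replaced by \<open>1 + t s\<^sup>2 z\<^sup>2\<close>. These turn out to be the Betti numbers of
  the quotient by \<open>Q\<^sub>m\<close>, for \<open>m \<ge> 0\<close>.\<close>

definition trunc_num :: "int \<Rightarrow> int \<Rightarrow> int \<Rightarrow> rat" where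
  "trunc_num m i d = gf_coeff m i d + gf_coeff (m - 2) (i - 1) (d - 2)"

text \<open>The two excluded indices are the exponents of \<open>z\<close> in the numerator.\<close>

lemma trunc_num_rec:
  assumes "m \<noteq> 0" "m \<noteq> 2"
  shows "trunc_num m i d = trunc_num (m - 1) i d + trunc_num (m - 4) (i - 1) (d - 3) + trunc_num (m - 4) (i - 2) (d - 4)"
  using gf_coeff_rec[of m i d] gf_coeff_rec[of "m - 2" "i - 1" "d - 2"] assms
  by (simp add: trunc_num_def algebra_simps)

lemma gf_coeff_cases:
  assumes "\<And>j. d = i + 2 * j \<Longrightarrow> gf_coeff m i d = binom (m - 3 * j) j * binom j (i - j) \<Longrightarrow> Q"
    and "odd (d - i) \<Longrightarrow> gf_coeff m i d = 0 \<Longrightarrow> Q"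
  shows Q
proof (cases "even (d - i)")
  case True
  hence "d = i + 2 * ((d - i) div 2)" by simp
  thus ?thesis using assms(1) True unfolding gf_coeff_def Let_def by presburger
qed (use assms(2) in \<open>simp add: gf_coeff_def\<close>)

lemma gf_coeff_neg: "m < 0 \<Longrightarrow> gf_coeff m i d = 0"
  by (rule gf_coeff_cases[of d i m]) (auto simp: binom_def)

lemma gf_coeff_0: "gf_coeff 0 i d = (if i = 0 \<and> d = 0 then 1 else 0)"
  by (rule gf_coeff_cases[of d i 0]) (auto simp: binom_def)

lemma trunc_num_neg: "m < 0 \<Longrightarrow> trunc_num m i d = 0"
  by (simp add: trunc_num_def gf_coeff_neg)

lemma trunc_num_0: "trunc_num 0 i d = (if i = 0 \<and> d = 0 then 1 else 0)"
  by (simp add: trunc_num_def gf_coeff_neg gf_coeff_0)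

lemma trunc_num_1: "trunc_num 1 i d = trunc_num 0 i d"
  using trunc_num_rec[of 1 i d] by (simp add: trunc_num_neg)

lemma trunc_num_2: "trunc_num 2 i d = trunc_num 0 i d + trunc_num 0 (i - 1) (d - 2)"
  using gf_coeff_rec[of 2 i d] gf_coeff_rec[of 1 i d] by (simp add: trunc_num_def gf_coeff_neg)

lemma trunc_num_3: "trunc_num 3 i d = trunc_num 2 i d"
  using trunc_num_rec[of 3 i d] by (simp add: trunc_num_neg)

text \<open>The Betti numbers of the quotient by the neighborhood ideal of a path. The recursive
  case is the mapping cone for the last end vertex; for a single vertex the ideal is generated by
  one variable.\<close>

fun path_num :: "nat \<Rightarrow> int \<Rightarrow> int \<Rightarrow> rat" where
  "path_num 0 i d = trunc_num 0 i d"
| "path_num (Suc 0) i d = trunc_num 0 i d + trunc_num 0 (i - 1) (d - 1)"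
| "path_num (Suc (Suc n)) i d = trunc_num (int n + 1) i d + path_num n (i - 1) (d - 2)"

text \<open>Parity leaves only the first summand of \<open>trunc_num\<close>. Trinomial revision
  isolates a factor that is unchanged along the recursion, and writing the other factor as a
  difference prepares the hockey-stick summation.\<close>

lemma trunc_num_case1:
  "trunc_num (int n + 1) (r + 1) (r + 2 * l + 3) =
     binom (int n - 2 * l - r - 2) (2 * l - r + 1) *
       (binom (int n - 3 * l - 1) (r - l) - binom (int n - 3 * l - 2) (r - l - 1))"
proof -
  have *: "(r + 2 * l + 3 - (r + 1)) div 2 = l + 1" "even (r + 2 * l + 3 - (r + 1))"
    "odd (r + 2 * l + 3 - 2 - (r + 1 - 1))"
    by simp_all
  have "trunc_num (int n + 1) (r + 1) (r + 2 * l + 3) = binom (int n - 3 * l - 2) (l + 1) * binom (l + 1) (r - l)"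
    unfolding trunc_num_def gf_coeff_def Let_def * using *(2,3) by (simp add: algebra_simps)
  also have "\<dots> = binom (int n - 2 * l - r - 2) (2 * l - r + 1) * binom (int n - 3 * l - 2) (r - l)"
    by (subst binom_trinomial) (simp add: algebra_simps)
  also have "\<dots> = binom (int n - 2 * l - r - 2) (2 * l - r + 1) *
       (binom (int n - 3 * l - 1) (r - l) - binom (int n - 3 * l - 2) (r - l - 1))"
  \<comment> \<open>This is the apex excluded from the Pascal rule; there the common factor has
    upper argument -1 and vanishes.\<close>
  proof (cases "int n - 3 * l - 1 = 0 \<and> r - l = 0")
    case True
    hence "binom (int n - 2 * l - r - 2) b = 0" for b by (simp add: binom_def)
    thus ?thesis by simp
  next
    case False
    thus ?thesis using binom_pascal[of "int n - 3 * l - 1" "r - l"] by simp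
  qed
  finally show ?thesis .
qed

text \<open>The opposite parity, where only the second summand of \<open>trunc_num\<close>
  survives.\<close>

lemma trunc_num_case2:
  "trunc_num (int n + 1) (r + 1) (r + 2 * l + 4) =
     binom (int n - 2 * l - r - 3) (2 * l - r + 2) *
       (binom (int n - 3 * l - 3) (r - l - 1) - binom (int n - 3 * l - 4) (r - l - 2))"
proof -
  have *: "(r + 2 * l + 4 - 2 - (r + 1 - 1)) div 2 = l + 1" "odd (r + 2 * l + 4 - (r + 1))"
    "even (r + 2 * l + 4 - 2 - (r + 1 - 1))"
    by simp_all
  have "trunc_num (int n + 1) (r + 1) (r + 2 * l + 4) = binom (int n - 3 * l - 4) (l + 1) * binom (l + 1) (r - l - 1)"
    unfolding trunc_num_def gf_coeff_def Let_def * using *(2,3) by (simp add: algebra_simps)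
  also have "\<dots> = binom (int n - 2 * l - r - 3) (2 * l - r + 2) * binom (int n - 3 * l - 4) (r - l - 1)"
    by (subst binom_trinomial) (simp add: algebra_simps)
  also have "\<dots> = binom (int n - 2 * l - r - 3) (2 * l - r + 2) *
       (binom (int n - 3 * l - 3) (r - l - 1) - binom (int n - 3 * l - 4) (r - l - 2))"
  proof (cases "int n - 3 * l - 3 = 0 \<and> r - l - 1 = 0")
    case True
    hence "binom (int n - 2 * l - r - 3) b = 0" for b by (simp add: binom_def)
    thus ?thesis by simp
  next
    case False
    thus ?thesis using binom_pascal[of "int n - 3 * l - 3" "r - l - 1"] by simp
  qed
  finally show ?thesis .
qed

text \<open>
  The summands of the claimed formula with floors written as \<open>div\<close>: \<open>terms3\<close> belongs to
  \<open>d = r + 2l + 3\<close> and \<open>terms4\<close> to \<open>d = r + 2l + 4\<close>. Here \<open>r\<close> is an integer because the induction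
  starts at \<open>r = -1\<close>.
\<close>

definition unit_terms :: "nat \<Rightarrow> int \<Rightarrow> int \<Rightarrow> rat" where
  "unit_terms n r d = (let k = int (n div 2) in
     binom \<bar>k - r - 1\<bar> (k - r - 1) * kronecker d (2 * r + 2)
     + (if odd n then 1 else 0) * kronecker r k * kronecker d (2 * r + 1))"

definition terms3 :: "nat \<Rightarrow> int \<Rightarrow> int \<Rightarrow> rat" where
  "terms3 n r l = (let q = min (int (n div 2)) (r + 1) in
     binom (int n - 2 * l - r - 4) (2 * l - r + 1) *
       (binom (int n - 3 * l - 3) (r - l)
        - binom (int n - 3 * l - 4 - q div 2) (r - l - 1 - q div 2)
        + binom (int n - 3 * l - 4) (r - l - 1)
        - binom (int n - 3 * l - 3 - (q + 1) div 2) (r - l - (q + 1) div 2)))"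

definition terms4 :: "nat \<Rightarrow> int \<Rightarrow> int \<Rightarrow> rat" where
  "terms4 n r l = (let q = min (int (n div 2)) (r + 1) in
     binom (int n - 2 * l - r - 5) (2 * l - r + 2) *
       (2 * binom (int n - 3 * l - 5) (r - l - 1)
        - binom (int n - 3 * l - 5 - q div 2) (r - l - 1 - q div 2)
        - binom (int n - 3 * l - 5 - (q + 1) div 2) (r - l - 1 - (q + 1) div 2)))"

lemma unit_terms_Suc_Suc: "unit_terms (Suc (Suc n)) r d = unit_terms n (r - 1) (d - 2)"
  by (auto simp: unit_terms_def Let_def kronecker_def)

text \<open>Passing to \<open>n + 2\<close> raises \<open>q\<close> by one: the new floor of its
  half is the old ceiling, and the new ceiling is the old floor plus 1. Hence the binomials
  containing \<open>q\<close> agree on both sides, and the remaining ones differ by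
  \<open>trunc_num_case1\<close>.\<close>

lemma terms3_Suc_Suc:
  "terms3 (Suc (Suc n)) r l = trunc_num (int n + 1) (r + 1) (r + 2 * l + 3) + terms4 n (r - 1) (l - 1)"
proof -
  define q where "q = min (int (n div 2)) r"
  have q: "min (int (Suc (Suc n) div 2)) (r + 1) = q + 1" "min (int (n div 2)) (r - 1 + 1) = q"
    by (auto simp: q_def)
  have q1: "(q + 1 + 1) div 2 = q div 2 + 1" by simp
  show ?thesis
    unfolding terms3_def terms4_def Let_def q q1 trunc_num_case1 by (simp add: algebra_simps)
qed

lemma terms4_Suc_Suc:
  "terms4 (Suc (Suc n)) r l = trunc_num (int n + 1) (r + 1) (r + 2 * l + 4) + terms3 n (r - 1) l"
proof -
  define q where "q = min (int (n div 2)) r"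
  have q: "min (int (Suc (Suc n) div 2)) (r + 1) = q + 1" "min (int (n div 2)) (r - 1 + 1) = q"
    by (auto simp: q_def)
  have q1: "(q + 1 + 1) div 2 = q div 2 + 1" by simp
  show ?thesis
    unfolding terms3_def terms4_def Let_def q q1 trunc_num_case2 by (simp add: algebra_simps)
qed

text \<open>The empty hockey-stick sum: for \<open>q = 0\<close> the binomials cancel in
  pairs.\<close>

lemma terms_q_zero:
  assumes "min (int (n div 2)) (r + 1) = 0"
  shows "terms3 n r l = 0" "terms4 n r l = 0"
  unfolding terms3_def terms4_def Let_def assms by simp_all

lemma path_num_neg: "i < 0 \<Longrightarrow> path_num n i d = 0"
proof (induction n i d rule: path_num.induct)
  case (3 n i d)
  have "trunc_num m i d = 0" for m
    using 3(2) by (auto simp: trunc_num_def gf_coeff_def Let_def binom_def)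
  thus ?case using 3 by simp
qed (simp_all add: trunc_num_0)

lemma trunc_num_hom_0: "trunc_num (int n + 1) 0 d = (if d = 0 then 1 else 0)"
proof -
  have "gf_coeff (int n + 1) 0 d = (if d = 0 then 1 else 0)"
    by (rule gf_coeff_cases[of d 0 "int n + 1"]) (auto simp: binom_def)
  moreover have "gf_coeff (int n + 1 - 2) (0 - 1) (d - 2) = 0"
    by (rule gf_coeff_cases[of "d - 2" "0 - 1" "int n + 1 - 2"]) (auto simp: binom_def)
  ultimately show ?thesis by (simp add: trunc_num_def)
qed

text \<open>Both parities are proved together because each step refers to the other one. The index
  \<open>l\<close> is arbitrary since the first equation calls the second at
  \<open>l - 1\<close>.\<close>

lemma path_num_closed_form:
  "r \<ge> -1 \<Longrightarrow>
    path_num n (r + 1) (r + 2 * l + 3) = unit_terms n r (r + 2 * l + 3) + terms3 n r l \<and>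
    path_num n (r + 1) (r + 2 * l + 4) = unit_terms n r (r + 2 * l + 4) + terms4 n r l"
proof (induction n arbitrary: r l rule: induct_nat_012)
  case 0
  have "min (int (0 div 2)) (r + 1) = 0" using 0 by simp
  from terms_q_zero[OF this] show ?case
    using 0 by (auto simp: trunc_num_0 unit_terms_def kronecker_def binom_def)
next
  case 1
  have "min (int (Suc 0 div 2)) (r + 1) = 0" using 1 by simp
  from terms_q_zero[OF this] show ?case
    using 1 by (auto simp: trunc_num_0 unit_terms_def kronecker_def binom_def)
next
  case (ge2 n)
  show ?case
  \<comment> \<open>This is homological degree 0 of the quotient: the only Betti number is that of
    R, which \<open>unit_terms\<close> records at degree \<open>2 * r + 2 = 0\<close>.\<close>
  proof (cases "r = -1")
    case True
    have "min (int (Suc (Suc n) div 2)) (r + 1) = 0" using True by simp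
    from terms_q_zero[OF this] show ?thesis
      by (simp add: True path_num_neg trunc_num_hom_0) (simp add: unit_terms_def kronecker_def binom_def)
  next
    case False
    hence r: "r - 1 \<ge> -1" using ge2.prems by simp
    from ge2.IH(1)[OF r, of "l - 1"] ge2.IH(1)[OF r, of l] show ?thesis
      unfolding path_num.simps unit_terms_Suc_Suc terms3_Suc_Suc terms4_Suc_Suc
      by (simp add: algebra_simps)
  qed
qed

section \<open>Paths\<close>

text \<open>
  By truncated subtraction \<open>window 2 = {1, 2}\<close>, the closed neighborhood of the end vertex \<open>1\<close>. The ideal
  \<open>Q\<^sub>c\<close> of the introduction is \<open>mono_ideal n (contains_window c)\<close>.
\<close>

definition window :: "nat \<Rightarrow> nat set" where
  "window j = {j - 2, j - 1, j} - {0}"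

definition contains_window :: "nat \<Rightarrow> nat set \<Rightarrow> bool" where
  "contains_window c A \<longleftrightarrow> (\<exists>j\<in>{2..c}. window j \<subseteq> A)"

text \<open>The ideal of the path on the first \<open>m\<close> vertices, to be viewed inside a ring
  with possibly more variables.\<close>

definition contains_neighborhood :: "nat \<Rightarrow> nat set \<Rightarrow> bool" where
  "contains_neighborhood m A \<longleftrightarrow> (\<exists>v\<in>{1..m}. {v - 1, v, v + 1} \<inter> {1..m} \<subseteq> A)"

section \<open>Colon ideals of window ideals\<close>

lemma contains_window_Suc:
  "contains_window (Suc c) A \<longleftrightarrow> contains_window c A \<or> (1 \<le> c \<and> window (Suc c) \<subseteq> A)"
proof (cases "1 \<le> c")
  case True
  hence "{2..Suc c} = insert (Suc c) {2..c}" by auto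
  thus ?thesis using True by (auto simp: contains_window_def)
qed (auto simp: contains_window_def)

lemma contains_window_mono: "contains_window c A \<Longrightarrow> A \<subseteq> B \<Longrightarrow> contains_window c B"
  unfolding contains_window_def by blast

lemma window_le: "x \<in> window j \<Longrightarrow> x \<le> j"
  by (auto simp: window_def)

lemma contains_window_union_above:
  assumes "\<And>x. x \<in> B \<Longrightarrow> c < x"
  shows "contains_window c (A \<union> B) \<longleftrightarrow> contains_window c A"
proof
  assume "contains_window c (A \<union> B)"
  then obtain j where j: "j \<in> {2..c}" "window j \<subseteq> A \<union> B" by (auto simp: contains_window_def)
  have "window j \<inter> B = {}" using assms window_le[of _ j] j(1) by fastforce
  with j(2) have "window j \<subseteq> A" by blast
  with j(1) show "contains_window c A" unfolding contains_window_def by blast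
qed (auto intro: contains_window_mono)

text \<open>The last three windows all contain \<open>c + 1\<close>, and the last of them needs
  nothing else once \<open>c + 2\<close> and \<open>c + 3\<close> are supplied. The new index
  \<open>c + 4\<close> lies in none of the windows, so both choices of \<open>B\<close> agree, as
  \<open>has_betti_insert\<close> requires.\<close>

lemma contains_window_colon:
  assumes "B = {c + 2, c + 3} \<or> B = {c + 4, c + 2, c + 3}"
  shows "contains_window (c + 3) (A \<union> B) \<longleftrightarrow> contains_window c A \<or> c + 1 \<in> A"
proof -
  have "c + 3 = Suc (Suc (Suc c))" by simp
  have "window (Suc (Suc (Suc c))) = {c + 1, c + 2, c + 3}" "c + 1 \<in> window (Suc (Suc c))" "c + 1 \<in> window (Suc c)"
    by (auto simp: window_def)
  moreover have "c + 1 \<notin> B" "c + 2 \<in> B" "c + 3 \<in> B" using assms by auto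
  moreover have "contains_window c (A \<union> B) \<longleftrightarrow> contains_window c A"
    by (rule contains_window_union_above) (use assms in auto)
  ultimately show ?thesis
    unfolding \<open>c + 3 = _\<close> contains_window_Suc by auto
qed

text \<open>The neighborhood of a vertex \<open>v < m\<close> is the window ending at
  \<open>v + 1\<close>; only the end vertex \<open>m\<close> yields a different set.\<close>

lemma contains_neighborhood_iff:
  assumes "1 \<le> m"
  shows "contains_neighborhood m A \<longleftrightarrow> contains_window m A \<or> {m - 1, m} - {0} \<subseteq> A"
proof -
  have "{1..m} = insert m {1..<m}" using assms by auto
  moreover have "{m - 1, m, m + 1} \<inter> {1..m} = {m - 1, m} - {0}" using assms by auto
  ultimately have "contains_neighborhood m A \<longleftrightarrow>
      (\<exists>v\<in>{1..<m}. {v - 1, v, v + 1} \<inter> {1..m} \<subseteq> A) \<or> {m - 1, m} - {0} \<subseteq> A"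
    unfolding contains_neighborhood_def by auto
  also have "(\<exists>v\<in>{1..<m}. {v - 1, v, v + 1} \<inter> {1..m} \<subseteq> A) \<longleftrightarrow> (\<exists>v\<in>{1..<m}. window (Suc v) \<subseteq> A)"
  proof (rule bex_cong[OF refl])
    fix v assume "v \<in> {1..<m}"
    hence "{v - 1, v, v + 1} \<inter> {1..m} = window (Suc v)" by (auto simp: window_def)
    thus "{v - 1, v, v + 1} \<inter> {1..m} \<subseteq> A \<longleftrightarrow> window (Suc v) \<subseteq> A" by simp
  qed
  also have "\<dots> \<longleftrightarrow> (\<exists>j\<in>Suc ` {1..<m}. window j \<subseteq> A)" by blast
  also have "Suc ` {1..<m} = {2..m}" by (auto simp: image_Suc_atLeastLessThan)
  finally show ?thesis by (simp add: contains_window_def)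
qed

text \<open>The neighborhood of \<open>m + 1\<close> contains that of the end vertex
  \<open>m + 2\<close>, so its generator is redundant.\<close>

lemma contains_neighborhood_Suc_Suc:
  "contains_neighborhood (m + 2) A \<longleftrightarrow> contains_window (m + 1) A \<or> {m + 2, m + 1} \<subseteq> A"
proof -
  have "contains_window (m + 2) A \<longleftrightarrow> contains_window (m + 1) A \<or> window (m + 2) \<subseteq> A"
    using contains_window_Suc[of "m + 1"] by simp
  moreover have "{m + 2, m + 1} \<subseteq> window (m + 2)" by (auto simp: window_def)
  ultimately show ?thesis by (subst contains_neighborhood_iff) auto
qed

text \<open>Removing \<open>m + 1\<close> from the last window leaves the neighborhood of
  \<open>m\<close> in the path that ends there. As before, the new index \<open>m + 2\<close> occurs
  in no window.\<close>

lemma contains_window_colon_neighborhood: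
  assumes "B = {m + 1} \<or> B = {m + 2, m + 1}"
  shows "contains_window (m + 1) (A \<union> B) \<longleftrightarrow> contains_neighborhood m A"
proof (cases "m = 0")
  case True
  thus ?thesis by (simp add: contains_window_def contains_neighborhood_def)
next
  case False
  have "window (Suc m) = insert (m + 1) ({m - 1, m} - {0})" by (auto simp: window_def)
  moreover have "m - 1 \<notin> B" "m \<notin> B" using assms by auto
  moreover have "m + 1 \<in> B" using assms by auto
  ultimately have "window (Suc m) \<subseteq> A \<union> B \<longleftrightarrow> {m - 1, m} - {0} \<subseteq> A" by auto
  moreover have "contains_window m (A \<union> B) \<longleftrightarrow> contains_window m A"
    by (rule contains_window_union_above) (use assms in auto)
  ultimately show ?thesis
    using False contains_window_Suc[of m "A \<union> B"] contains_neighborhood_iff[of m A] by auto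
qed

section \<open>Betti tables of window and neighborhood ideals\<close>

text \<open>From index 4 on, two mapping cones reproduce \<open>trunc_num_rec\<close>. Below that,
  the ideal is zero, then generated by the first edge, and \<open>window 3\<close> adds nothing to
  \<open>window 2\<close>.\<close>

lemma has_betti_contains_window:
  "c \<le> n \<Longrightarrow> has_betti TYPE('k::field) n (contains_window c) (trunc_num (int c))"
proof (induction c rule: less_induct)
  case (less c)
  note base = has_betti_False[where ?'k = 'k, of n]
  have "c < 2 \<or> c = 2 \<or> c = 3 \<or> (\<exists>c'. c = c' + 4)" by presburger
  then consider "c < 2" | "c = 2" | "c = 3" | c' where "c = c' + 4" by blast
  thus ?case
  proof cases
    case 1
    show ?thesis
      by (rule has_betti_cong[OF base])
        (use 1 in \<open>auto simp: contains_window_def trunc_num_0 trunc_num_1 less_2_cases_iff\<close>)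
  next
    case 2
    have *: "has_betti TYPE('k) n (\<lambda>A. False \<or> insert 2 {1} \<subseteq> A) (\<lambda>i d. (if i = 0 \<and> d = 0 then 1 else 0) +
        (if i - 1 = 0 \<and> d - (int (card {1::nat}) + 1) = 0 then 1 else 0))"
      using less.prems 2 by (intro has_betti_insert[OF base base]) simp_all
    show ?thesis
      by (rule has_betti_cong[OF *])
        (use 2 in \<open>auto simp: contains_window_def window_def trunc_num_2 trunc_num_0\<close>)
  next
    case 3
    have "has_betti TYPE('k) n (contains_window 2) (trunc_num (int 2))"
      using less.prems 3 by (intro less.IH) auto
    thus ?thesis
    proof (rule has_betti_cong)
      have "contains_window (Suc 2) A \<longleftrightarrow> contains_window 2 A" for A
        unfolding contains_window_Suc by (auto simp: contains_window_def window_def)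
      thus "contains_window 2 A \<longleftrightarrow> contains_window c A" for A by (simp add: 3)
    qed (simp add: 3 trunc_num_3)
  next
    case (4 c')
    have IH: "has_betti TYPE('k) n (contains_window c') (trunc_num (int c'))"
      "has_betti TYPE('k) n (contains_window (c' + 3)) (trunc_num (int (c' + 3)))"
      by (rule less.IH; use less.prems 4 in simp)+
    \<comment> \<open>The variable \<open>c' + 1\<close> does not occur in the ideal of
      \<open>contains_window c'\<close>, which is therefore its own colon ideal; both inputs are
      \<open>IH(1)\<close>.\<close>
    have colon: "has_betti TYPE('k) n (\<lambda>A. contains_window c' A \<or> insert (c' + 1) {} \<subseteq> A)
        (\<lambda>i d. trunc_num (int c') i d + trunc_num (int c') (i - 1) (d - (int (card ({} :: nat set)) + 1)))"
      by (rule has_betti_insert[OF IH(1) IH(1)])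
        (use less.prems 4 in \<open>auto simp: contains_window_union_above[of "{c' + 1}" c', simplified]\<close>)
    have *: "has_betti TYPE('k) n (\<lambda>A. contains_window (c' + 3) A \<or> insert (c' + 4) {c' + 2, c' + 3} \<subseteq> A)
      (\<lambda>i d. trunc_num (int (c' + 3)) i d +
        (trunc_num (int c') (i - 1) (d - (int (card {c' + 2, c' + 3}) + 1)) +
         trunc_num (int c') (i - 1 - 1) (d - (int (card {c' + 2, c' + 3}) + 1) - (int (card ({} :: nat set)) + 1))))"
      by (rule has_betti_insert[OF IH(2) colon])
        (use less.prems 4 contains_window_colon[of "{c' + 2, c' + 3}" c'] contains_window_colon[of "{c' + 4, c' + 2, c' + 3}" c'] in auto)
    show ?thesis
    proof (rule has_betti_cong[OF *])
      show "contains_window (c' + 3) A \<or> insert (c' + 4) {c' + 2, c' + 3} \<subseteq> A \<longleftrightarrow> contains_window c A" for A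
      proof -
        have "window (Suc (c' + 3)) = insert (c' + 4) {c' + 2, c' + 3}" by (auto simp: window_def)
        thus ?thesis using contains_window_Suc[of "c' + 3" A] by (simp add: 4 add.commute[of 4])
      qed
      show "trunc_num (int (c' + 3)) i d +
        (trunc_num (int c') (i - 1) (d - (int (card {c' + 2, c' + 3}) + 1)) +
         trunc_num (int c') (i - 1 - 1) (d - (int (card {c' + 2, c' + 3}) + 1) - (int (card ({} :: nat set)) + 1)))
         = trunc_num (int c) i d" for i d
        using trunc_num_rec[of "int c" i d] by (simp add: 4 add.commute[of 3])
    qed
  qed
qed

lemma has_betti_contains_neighborhood:
  "m \<le> n \<Longrightarrow> has_betti TYPE('k::field) n (contains_neighborhood m) (path_num m)"
proof (induction m rule: induct_nat_012)
  case 0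
  show ?case by (rule has_betti_cong[OF has_betti_False]) (auto simp: contains_neighborhood_def trunc_num_0)
next
  case 1
  note base = has_betti_False[where ?'k = 'k, of n]
  have *: "has_betti TYPE('k) n (\<lambda>A. False \<or> insert 1 {} \<subseteq> A) (\<lambda>i d. (if i = 0 \<and> d = 0 then 1 else 0) +
      (if i - 1 = 0 \<and> d - (int (card ({} :: nat set)) + 1) = 0 then 1 else 0))"
    by (rule has_betti_insert[OF base base]) (use 1 in auto)
  show ?case
    by (rule has_betti_cong[OF *]) (auto simp: contains_neighborhood_def trunc_num_0)
next
  case (ge2 m)
  have *: "has_betti TYPE('k) n (\<lambda>A. contains_window (m + 1) A \<or> insert (m + 2) {m + 1} \<subseteq> A)
      (\<lambda>i d. trunc_num (int (m + 1)) i d + path_num m (i - 1) (d - (int (card {m + 1}) + 1)))"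
    by (rule has_betti_insert[OF has_betti_contains_window ge2.IH(1)])
      (use ge2.prems contains_window_colon_neighborhood[of "{m + 1}" m] contains_window_colon_neighborhood[of "{m + 2, m + 1}" m] in auto)
  show ?case
    by (rule has_betti_cong[OF *])
      (use contains_neighborhood_Suc_Suc[of m] in \<open>auto simp: add.commute\<close>)
qed

section \<open>Identification with the neighborhood ideal of a path\<close>

lemma mono_ideal_ideal:
  assumes "\<And>A B. P A \<Longrightarrow> A \<subseteq> B \<Longrightarrow> P B"
  shows "ideal (mono_ideal n P :: 'k::field mpoly set) (poly_ring n)"
proof -
  interpret cring "poly_ring n :: 'k mpoly ring" by (rule cring_poly_ring)
  have ops: "x \<oplus>\<^bsub>poly_ring n\<^esub> y = x + y" "x \<otimes>\<^bsub>poly_ring n\<^esub> y = x * y"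
      "\<zero>\<^bsub>poly_ring n\<^esub> = (0 :: 'k mpoly)" for x y :: "'k mpoly"
    by (simp_all add: poly_ring_def)
  have uminus: "\<ominus>\<^bsub>poly_ring n\<^esub> x = - x" if "x \<in> R n" for x :: "'k mpoly"
    using that by (intro minus_equality) (simp_all add: ops)
  have mult: "x * a \<in> mono_ideal n P" if "a \<in> mono_ideal n P" "x \<in> R n" for a x :: "'k mpoly"
  proof -
    have "supported (\<lambda>m. P (Poly_Mapping.keys m)) (x * a)"
      by (rule supported_mult[of "\<lambda>_. True" _ "\<lambda>m. P (Poly_Mapping.keys m)"])
        (use that assms in \<open>auto simp: mono_ideal_def keys_add_nat, auto simp: supported_def\<close>)
    thus ?thesis using that by (simp add: mono_ideal_def)
  qed
  show ?thesis
  proof (rule idealI)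
    show "subgroup (mono_ideal n P :: 'k mpoly set) (add_monoid (poly_ring n))"
    proof (rule add.subgroupI)
      fix a :: "'k mpoly" assume "a \<in> mono_ideal n P"
      thus "\<ominus>\<^bsub>poly_ring n\<^esub> a \<in> mono_ideal n P"
        by (simp add: mono_ideal_def uminus)
    next
      have "0 \<in> (mono_ideal n P :: 'k mpoly set)" by (simp add: mono_ideal_def)
      thus "mono_ideal n P \<noteq> ({} :: 'k mpoly set)" by blast
    qed (auto simp: mono_ideal_def ops supported_add)
  qed (use mult in \<open>auto simp: ops mult.commute ring_axioms\<close>)
qed

text \<open>Every monomial of a member of the right side is a multiple of some generator, so it lies
  in the generated ideal, and hence so does the sum.\<close>

lemma genideal_xmon:
  assumes F: "\<And>A. A \<in> F \<Longrightarrow> A \<subseteq> {1..n}"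
  shows "Idl\<^bsub>poly_ring n\<^esub> (xmon ` F) = (mono_ideal n (\<lambda>A. \<exists>B\<in>F. B \<subseteq> A) :: 'k::field mpoly set)" (is "?I = ?M")
proof (rule subset_antisym)
  interpret cring "poly_ring n :: 'k mpoly ring" by (rule cring_poly_ring)
  have fin: "finite A" if "A \<in> F" for A using F[OF that] finite_subset by blast
  have gens: "xmon ` F \<subseteq> (R n :: 'k mpoly set)"
    using F fin by (auto simp: carrier_supported supported_xmon keys_sqfree)
  have "xmon ` F \<subseteq> ?M"
    using gens by (auto simp: mono_ideal_def supported_xmon keys_sqfree fin)
  moreover have "ideal ?M (poly_ring n)"
    by (rule mono_ideal_ideal) blast
  ultimately show "?I \<subseteq> ?M" by (rule genideal_minimal[rotated])
  interpret I: ideal ?I "poly_ring n :: 'k mpoly ring" by (rule genideal_ideal[OF gens])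
  have ops: "x \<oplus>\<^bsub>poly_ring n\<^esub> y = x + y" "x \<otimes>\<^bsub>poly_ring n\<^esub> y = x * y"
      "\<zero>\<^bsub>poly_ring n\<^esub> = (0 :: 'k mpoly)" for x y :: "'k mpoly"
    by (simp_all add: poly_ring_def)
  have sum: "sum f K \<in> ?I" if "\<And>m. m \<in> K \<Longrightarrow> f m \<in> ?I" for f :: "(nat \<Rightarrow>\<^sub>0 nat) \<Rightarrow> 'k mpoly" and K
    using that
    by (induction K rule: infinite_finite_induct) (use I.zero_closed I.a_closed in \<open>auto simp: ops\<close>)
  show "?M \<subseteq> ?I"
  proof
    fix p :: "'k mpoly" assume p: "p \<in> ?M"
    have "Poly_Mapping.single m c \<in> ?I" if m: "m \<in> Poly_Mapping.keys p" for m c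
    proof -
      obtain A where A: "A \<in> F" "A \<subseteq> Poly_Mapping.keys m"
        using p m by (auto simp: mono_ideal_def supported_def)
      have "Poly_Mapping.keys m \<subseteq> {1..n}"
        using p m unfolding mono_ideal_def carrier_supported supported_def by blast
      hence "Poly_Mapping.single (m - sqfree A) c \<in> R n" by (rule single_diff_in_R)
      moreover have "xmon A \<in> ?I" using genideal_self[OF gens] A(1) by blast
      ultimately have "Poly_Mapping.single (m - sqfree A) c * xmon A \<in> ?I"
        using I.I_l_closed by (simp add: ops)
      thus ?thesis by (subst single_div_xmon[OF fin[OF A(1)] A(2)])
    qed
    thus "p \<in> ?I" by (subst poly_mapping_sum_single) (rule sum)
  qed
qed

text \<open>The intersection removes the out-of-range values 0 and \<open>n + 1\<close> at the two
  ends.\<close>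

lemma closed_neighborhood_path:
  assumes "v \<in> {1..n}"
  shows "closed_neighborhood {1..n} (path_edges n) v = {v - 1, v, v + 1} \<inter> {1..n}"
proof -
  have "{u, v} \<in> path_edges n \<longleftrightarrow> u = v + 1 \<or> v = u + 1" if "u \<in> {1..n}" for u
    using that assms by (auto simp: path_edges_def doubleton_eq_iff)
  hence "closed_neighborhood {1..n} (path_edges n) v = {u \<in> {1..n}. u = v \<or> u = v + 1 \<or> v = u + 1}"
    unfolding closed_neighborhood_def by (intro Collect_cong) blast
  also have "\<dots> = {v - 1, v, v + 1} \<inter> {1..n}" using assms by auto
  finally show ?thesis .
qed

lemma neighborhood_ideal_path:
  "neighborhood_ideal n (path_edges n) = (mono_ideal n (contains_neighborhood n) :: 'k::field mpoly set)"
proof -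
  let ?N = "\<lambda>v. {v - 1, v, v + 1} \<inter> {1..n}"
  have "(\<lambda>v. \<Prod>y\<in>closed_neighborhood {1..n} (path_edges n) v. var y :: 'k mpoly) ` {1..n} = xmon ` ?N ` {1..n}"
    unfolding image_image by (intro image_cong refl) (simp only: closed_neighborhood_path, simp add: xmon_eq_prod)
  moreover have "contains_neighborhood n = (\<lambda>A. \<exists>B\<in>?N ` {1..n}. B \<subseteq> A)"
    unfolding contains_neighborhood_def by (intro ext) blast
  moreover have "Idl\<^bsub>poly_ring n\<^esub> (xmon ` ?N ` {1..n}) = (mono_ideal n (\<lambda>A. \<exists>B\<in>?N ` {1..n}. B \<subseteq> A) :: 'k mpoly set)"
    by (rule genideal_xmon) blast
  ultimately show ?thesis
    unfolding neighborhood_ideal_def by (simp only:)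
qed

lemma graded_betti_of_has_betti:
  assumes "has_betti TYPE('k::field) n P \<beta>"
  shows "of_nat (graded_betti n (mono_ideal n P :: 'k mpoly set) r d) = \<beta> (int r + 1) d"
proof -
  obtain S D where "res n (mono_ideal n P :: 'k mpoly set) S D" "\<And>i d. of_nat (count_list (S i) d) = \<beta> (int i) d"
    using assms by (auto simp: has_betti_def)
  thus ?thesis by (simp add: graded_betti_eq add.commute)
qed

theorem corollary4p7:
  fixes n r :: nat and k q l d :: int
  assumes "n \<ge> 2"
    and "k = \<lfloor>of_nat n / (2::rat)\<rfloor>"
    and "q = min k (int r + 1)"
    and "l \<ge> -1"
  shows "(d = int r + 2 * l + 3 \<longrightarrow>
      of_nat (graded_betti n (neighborhood_ideal n (path_edges n) :: 'k::field mpoly set) r d) =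
        binom \<bar>k - int r - 1\<bar> (k - int r - 1) * kronecker d (2 * int r + 2)
        + binom (int n - 2 * l - int r - 4) (2 * l - int r + 1) *
          (binom (int n - 3 * l - 3) (int r - l)
           - binom (int n - 3 * l - 4 - \<lfloor>of_int q / (2::rat)\<rfloor>)
                   (int r - l - 1 - \<lfloor>of_int q / (2::rat)\<rfloor>)
           + binom (int n - 3 * l - 4) (int r - l - 1)
           - binom (int n - 3 * l - 3 - \<lceil>of_int q / (2::rat)\<rceil>)
                   (int r - l - \<lceil>of_int q / (2::rat)\<rceil>))
        + ((1 + (-1) ^ (n - 1)) / 2) * kronecker (int r) k * kronecker d (2 * int r + 1))
    \<and> (d = int r + 2 * l + 4 \<longrightarrow>
      of_nat (graded_betti n (neighborhood_ideal n (path_edges n) :: 'k::field mpoly set) r d) =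
        binom \<bar>k - int r - 1\<bar> (k - int r - 1) * kronecker d (2 * int r + 2)
        + binom (int n - 2 * l - int r - 5) (2 * l - int r + 2) *
          (2 * binom (int n - 3 * l - 5) (int r - l - 1)
           - binom (int n - 3 * l - 5 - \<lfloor>of_int q / (2::rat)\<rfloor>)
                   (int r - l - 1 - \<lfloor>of_int q / (2::rat)\<rfloor>)
           - binom (int n - 3 * l - 5 - \<lceil>of_int q / (2::rat)\<rceil>)
                   (int r - l - 1 - \<lceil>of_int q / (2::rat)\<rceil>))
        + ((1 + (-1) ^ (n - 1)) / 2) * kronecker (int r) k * kronecker d (2 * int r + 1))"
proof -
  \<comment> \<open>Homological degree \<open>r\<close> of the ideal is degree \<open>r + 1\<close>
    of the quotient.\<close>
  have betti: "of_nat (graded_betti n (neighborhood_ideal n (path_edges n) :: 'k mpoly set) r d) =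
      path_num n (int r + 1) d"
    unfolding neighborhood_ideal_path
    by (rule graded_betti_of_has_betti[OF has_betti_contains_neighborhood]) simp
  have k: "k = int (n div 2)"
    using floor_divide_of_nat_eq[of n 2, where ?'a = rat] assms(2) by simp
  have floor: "\<lfloor>of_int q / (2::rat)\<rfloor> = q div 2"
    using floor_divide_of_int_eq[of q 2, where ?'a = rat] by simp
  have "\<lceil>of_int q / (2::rat)\<rceil> = - (- q div 2)"
    using ceiling_divide_eq_div[of q 2, where ?'a = rat] by simp
  also have "\<dots> = (q + 1) div 2" by presburger
  finally have ceiling: "\<lceil>of_int q / (2::rat)\<rceil> = (q + 1) div 2" .
  \<comment> \<open>The bound on \<open>n\<close> enters here: at \<open>n = 0\<close> truncated
    subtraction would make the left side 1.\<close>
  have parity: "(1 + (-1) ^ (n - 1)) / 2 = (if odd n then 1 else 0 :: rat)"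
    using assms(1) by (cases "even n") auto
  show ?thesis
    using path_num_closed_form[of "int r" n l]
    unfolding betti floor ceiling parity unit_terms_def terms3_def terms4_def Let_def
      k[symmetric] assms(3)[symmetric]
    by auto
qed

end
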